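(* Let $k>1$ be an integer. Then $\mathcal{L}_k \subseteq (\tfrac{\sqrt5}{2k-1},\infty)$, and $\tfrac{\sqrt5}{2k-1}$ is the least accumulation point of $\mathcal{L}_k$. In particular, $\mathcal{L}_k$ is not closed.
   Context: The Sturmian word of slope $\alpha$ (irrational) and intercept $x\in[0,1)$ has $n$-th letter ($n\ge0$) $0$ if $\{x+n\alpha\}\in[0,\{1-\alpha\})$ and $1$ otherwise (or the analogous left-open convention), $\{\cdot\}$ the fractional part. Two words are $k$-abelian equivalent if every nonempty word of length at most $k$ occurs as a factor equally often in both. A $k$-abelian power of period $m$ and exponent $n$ is a concatenation of $n$ pairwise $k$-abelian equivalent words of length $m$. $\mathrm{ab}_{k,\alpha}(m)$ is the maximum exponent of a $k$-abelian power of period $m$ occurring in a Sturmian word of slope $\alpha$, and $A_k(\alpha)=\limsup_{m\to\infty}\mathrm{ab}_{k,\alpha}(m)/m$. The $k$-Lagrange spectrum is $\mathcal{L}_k=\{A_k(\alpha):\alpha \text{ irrational}\}\cap\mathbb{R}$. *)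

theory Defs
  imports "HOL-Analysis.Analysis"
begin

text \<open>Finite words are lists, infinite words are functions on \<open>nat\<close>, and the letters are the
  natural numbers 0 and 1.\<close>

definition sturmian_lower :: "real \<Rightarrow> real \<Rightarrow> nat \<Rightarrow> nat" where
  "sturmian_lower \<alpha> x n = (if frac (x + real n * \<alpha>) \<in> {0..<frac (1 - \<alpha>)} then 0 else 1)"

text \<open>Left-open convention: the circle is split into \<open>(0, {1 - \<alpha>}]\<close> and \<open>({1 - \<alpha>}, 1]\<close>.
  The point 1 is represented by 0, since \<^const>\<open>frac\<close> takes values in \<open>[0, 1)\<close>; so a
  fractional part equal to 0 gives the letter 1.\<close>

definition sturmian_upper :: "real \<Rightarrow> real \<Rightarrow> nat \<Rightarrow> nat" where
  "sturmian_upper \<alpha> x n = (if frac (x + real n * \<alpha>) \<in> {0<..frac (1 - \<alpha>)} then 0 else 1)"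

definition sturmian_word :: "real \<Rightarrow> (nat \<Rightarrow> nat) \<Rightarrow> bool" where
  "sturmian_word \<alpha> w \<longleftrightarrow> (\<exists>x\<in>{0..<1}. w = sturmian_lower \<alpha> x \<or> w = sturmian_upper \<alpha> x)"

definition occurs_in :: "'a list \<Rightarrow> (nat \<Rightarrow> 'a) \<Rightarrow> bool" where
  "occurs_in u w \<longleftrightarrow> (\<exists>i. map w [i..<i + length u] = u)"

definition num_occurrences :: "'a list \<Rightarrow> 'a list \<Rightarrow> nat" where
  "num_occurrences z u =
     card {i. i + length z \<le> length u \<and> take (length z) (drop i u) = z}"

definition k_abelian_equiv :: "nat \<Rightarrow> 'a list \<Rightarrow> 'a list \<Rightarrow> bool" where
  "k_abelian_equiv k u v \<longleftrightarrow>
     (\<forall>z. z \<noteq> [] \<and> length z \<le> k \<longrightarrow> num_occurrences z u = num_occurrences z v)"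

definition k_abelian_power :: "nat \<Rightarrow> nat \<Rightarrow> nat \<Rightarrow> 'a list \<Rightarrow> bool" where
  "k_abelian_power k m n p \<longleftrightarrow>
     (\<exists>us. length us = n \<and> (\<forall>u\<in>set us. length u = m) \<and>
           (\<forall>u\<in>set us. \<forall>v\<in>set us. k_abelian_equiv k u v) \<and> p = concat us)"

text \<open>For \<open>k \<ge> 1\<close>, \<open>m \<ge> 1\<close> and irrational \<open>\<alpha>\<close> the set of exponents is finite: the \<open>n\<close> blocks all
  contain the same number \<open>c\<close> of letters 1, and by balance \<open>n * \<bar>c - m * {\<alpha>}\<bar>\<close> is bounded.
  It contains 1, so the maximum exists. The value at \<open>m = 0\<close> is irrelevant for the limit
  superior below.\<close>

definition max_exponent :: "nat \<Rightarrow> real \<Rightarrow> nat \<Rightarrow> nat" where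
  "max_exponent k \<alpha> m =
     Max {n. \<exists>w p. sturmian_word \<alpha> w \<and> k_abelian_power k m n p \<and> occurs_in p w}"

definition k_lagrange_constant :: "nat \<Rightarrow> real \<Rightarrow> ereal" where
  "k_lagrange_constant k \<alpha> = limsup (\<lambda>m. ereal (real (max_exponent k \<alpha> m) / real m))"

definition k_lagrange_spectrum :: "nat \<Rightarrow> real set" where
  "k_lagrange_spectrum k = {r. \<exists>\<alpha>. \<alpha> \<notin> \<rat> \<and> k_lagrange_constant k \<alpha> = ereal r}"

end

theory Submission
  imports Defs "HOL-Real_Asymp.Real_Asymp" "HOL-Computational_Algebra.Primes"
begin

text \<open>Let \<open>\<beta> = {\<alpha>}\<close>. The blocks of a power of period \<open>m\<close> start at points moving by \<open>m \<beta>\<close>, and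
  they are \<open>k\<close>-abelian equivalent exactly as long as these points stay in one of the \<open>2k - 1\<close>
  arcs cut out by the points \<open>j \<beta>\<close>, \<open>\<bar>j\<bar> < k\<close>. So the exponent is \<open>L / \<parallel>m \<beta>\<parallel>\<close> up to a bounded
  error, where \<open>L\<close> is the length of the longest arc. Here \<open>L > 1 / (2k - 1)\<close>, since equal arcs
  would force \<open>\<beta>\<close> to be rational, and Hurwitz' theorem gives \<open>m \<parallel>m \<beta>\<parallel> < 1 / \<surd>5\<close> infinitely often:
  the bound \<open>\<surd>5 / (2k - 1)\<close> is strict. It is approached by slopes equivalent to the golden ratio,
  for which \<open>\<surd>5\<close> cannot be improved, that tend to \<open>1 / (2k - 1)\<close>.\<close>

subsection \<open>Hurwitz' theorem\<close>

text \<open>Only one half of the "exactly" is proved for every slope: boundaries staying in one arc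
  give a power. The number of occurrences of a factor in a block is a step function summed along the
  orbit, and the sum reduces to terms at the two ends of the block. The converse is proved only for
  slopes with 0 < \<alpha> <= 1/(2k - 1) and L < 1/2, which suffices for those approaching the
  bound. There the arcs are explicit: 2k - 2 of length \<alpha> and one of length L = 1 - (2k - 2)
  \<alpha> >= \<alpha>, which tends to 1/(2k - 1). Equivalent blocks share their first and last k -
  1 letters, and these 2k - 2 letters around a boundary confine the orbit to an interval of length
  L. Strictness survives the limit superior because L does not depend on the period m.\<close>

lemma sqrt_5_irrational: "sqrt 5 \<notin> \<rat>"
proof
  assume "sqrt 5 \<in> \<rat>"
  then obtain m n :: nat
    where n: "n \<noteq> 0" and eq: "\<bar>sqrt 5\<bar> = real m / real n" and cop: "coprime m n"
    by (rule Rats_abs_nat_div_natE)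
  from n eq have "real m = sqrt 5 * real n"
    by (simp add: field_simps)
  then have "(real m)\<^sup>2 = 5 * (real n)\<^sup>2"
    by (simp add: power_mult_distrib)
  then have sq: "m\<^sup>2 = 5 * n\<^sup>2"
    by (metis of_nat_eq_iff of_nat_mult of_nat_numeral of_nat_power)
  have p: "prime (5::nat)"
    by (simp add: prime_nat_iff' atLeastLessThan_nat_numeral)
  from sq have "5 dvd m"
    using p by (metis dvd_triv_left prime_dvd_power)
  then obtain j where "m = 5 * j" ..
  with sq have "n\<^sup>2 = 5 * j\<^sup>2"
    by (simp add: power_mult_distrib)
  then have "5 dvd n"
    using p by (metis dvd_triv_left prime_dvd_power)
  with \<open>5 dvd m\<close> cop show False
    using p by (metis coprime_common_divisor not_prime_unit)
qed

lemma irrational_mult_int_ne: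
  fixes x :: real
  assumes "x \<notin> \<rat>" "q \<noteq> 0"
  shows "of_int q * x \<noteq> of_int p"
proof
  assume "of_int q * x = of_int p"
  then have "x = of_int p / of_int q"
    using assms(2) by (simp add: field_simps)
  with assms(1) show False by simp
qed

text \<open>Descent in the Stern-Brocot tree: inserting the mediant (a + c)/(b + d) keeps the
  determinant 1, and replacing the neighbour on its side of x raises b + d by at least 1. Large b +
  d is what excludes small denominators in \<open>hurwitz\<close>.\<close>

lemma farey_neighbours:
  fixes x :: real
  assumes "x \<notin> \<rat>"
  shows "\<exists>a b c d :: int. b > 0 \<and> d > 0 \<and> b * c - a * d = 1 \<and> of_int a < of_int b * x \<and>
           of_int d * x < of_int c \<and> b + d \<ge> int s + 2"
proof (induction s)
  case 0
  have "of_int \<lfloor>x\<rfloor> \<noteq> x"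
    using assms by (metis Rats_of_int)
  then have "of_int \<lfloor>x\<rfloor> < x" by linarith
  moreover have "x < of_int (\<lfloor>x\<rfloor> + 1)" by linarith
  ultimately show ?case
    by (intro exI[of _ "\<lfloor>x\<rfloor>"] exI[of _ 1] exI[of _ "\<lfloor>x\<rfloor> + 1"]) simp
next
  case (Suc s)
  then obtain a b c d :: int
    where h: "b > 0" "d > 0" "b * c - a * d = 1" "of_int a < of_int b * x"
      "of_int d * x < of_int c" "b + d \<ge> int s + 2"
    by blast
  have "of_int (b + d) * x \<noteq> of_int (a + c)"
    using h(1,2) assms by (intro irrational_mult_int_ne) auto
  then consider "of_int (a + c) < of_int (b + d) * x" | "of_int (b + d) * x < of_int (a + c)"
    by linarith
  then show ?case
  proof cases
    case 1
    then show ?thesis using h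
      by (intro exI[of _ "a + c"] exI[of _ "b + d"] exI[of _ c] exI[of _ d])
        (auto simp: algebra_simps)
  next
    case 2
    then show ?thesis using h
      by (intro exI[of _ a] exI[of _ b] exI[of _ "a + c"] exI[of _ "b + d"])
        (auto simp: algebra_simps)
  qed
qed

text \<open>Twice the sum of the two inequalities reads \<open>((\<surd>5 - 1) X - 2 Y)\<^sup>2 \<le> 0\<close>.\<close>

lemma hurwitz_contradiction:
  fixes X Y :: int
  assumes "X > 0" and "sqrt 5 * X * Y \<ge> (real_of_int X)\<^sup>2 + (real_of_int Y)\<^sup>2"
    and "sqrt 5 * X * (X + Y) \<ge> (real_of_int X)\<^sup>2 + (real_of_int (X + Y))\<^sup>2"
  shows False
proof -
  have "((sqrt 5 - 1) * X - 2 * Y)\<^sup>2 =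
      2 * ((real_of_int X)\<^sup>2 + (real_of_int Y)\<^sup>2 - sqrt 5 * X * Y) +
      2 * ((real_of_int X)\<^sup>2 + (real_of_int (X + Y))\<^sup>2 - sqrt 5 * X * (X + Y)) +
      (sqrt 5 * sqrt 5 - 5) * (real_of_int X)\<^sup>2"
    by (simp add: power2_eq_square algebra_simps)
  also have "\<dots> \<le> 0" using assms(2,3) by simp
  finally have "(sqrt 5 - 1) * X = 2 * Y" by simp
  then have "sqrt 5 = 1 + 2 * of_int Y / of_int X"
    using assms(1) by (simp add: field_simps)
  also have "\<dots> \<in> \<rat>" by (intro Rats_add Rats_divide Rats_mult) auto
  finally show False using sqrt_5_irrational by simp
qed

text \<open>If all three fail, the determinant identity \<open>d * u + b * v = 1\<close>, multiplied
  by \<open>sqrt 5 * b * d\<close>, gives b^2 + d^2 <= sqrt 5 b d. The mediant and the neighbour on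
  the other side of x satisfy an identity of the same shape, hence a second such inequality;
  \<open>hurwitz_contradiction\<close> excludes the two together.\<close>

lemma hurwitz_farey:
  fixes x :: real and a b c d :: int
  assumes "b > 0" "d > 0" "b * c - a * d = 1" "of_int a < of_int b * x" "of_int d * x < of_int c"
  shows "sqrt 5 * b * \<bar>b * x - a\<bar> < 1 \<or> sqrt 5 * d * \<bar>d * x - c\<bar> < 1 \<or>
    sqrt 5 * (b + d) * \<bar>(b + d) * x - (a + c)\<bar> < 1"
proof (rule ccontr)
  define u where "u = b * x - a"
  define v where "v = c - d * x"
  have pos: "u > 0" "v > 0"
    using assms by (auto simp: u_def v_def)
  have "real_of_int (b * c - a * d) = 1" using assms(3) by simp
  then have uv: "d * u + b * v = 1"
    by (simp add: u_def v_def algebra_simps)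
  assume "\<not> ?thesis"
  moreover have "\<bar>b * x - a\<bar> = u" "\<bar>d * x - c\<bar> = v"
    using pos by (auto simp: u_def v_def)
  moreover have "(b + d) * x - (a + c) = u - v"
    by (simp add: u_def v_def algebra_simps)
  ultimately have ge: "sqrt 5 * b * u \<ge> 1" "sqrt 5 * d * v \<ge> 1" "sqrt 5 * (b + d) * \<bar>u - v\<bar> \<ge> 1"
    by (auto simp: not_less)
  have sq: "y\<^sup>2 \<le> t * y\<^sup>2" if "t \<ge> 1" for t y :: real
    using mult_right_mono[OF that, of "y\<^sup>2"] by simp
  have "sqrt 5 * b * d = sqrt 5 * b * d * (d * u + b * v)" by (simp add: uv)
  also have "\<dots> = (sqrt 5 * d * v) * (real_of_int b)\<^sup>2 + (sqrt 5 * b * u) * (real_of_int d)\<^sup>2"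
    by (simp add: power2_eq_square algebra_simps)
  also have "\<dots> \<ge> (real_of_int b)\<^sup>2 + (real_of_int d)\<^sup>2"
    using sq[OF ge(1)] sq[OF ge(2)] by (intro add_mono)
  finally have 1: "sqrt 5 * b * d \<ge> (real_of_int b)\<^sup>2 + (real_of_int d)\<^sup>2" .
  show False
  proof (cases "u < v")
    case True
    then have ge3: "sqrt 5 * (b + d) * (v - u) \<ge> 1" using ge(3) by simp
    have "b * (v - u) + (b + d) * u = 1"
      using uv by (simp add: algebra_simps)
    then have "sqrt 5 * b * (b + d) = sqrt 5 * b * (b + d) * (b * (v - u) + (b + d) * u)"
      by simp
    also have "\<dots> = (sqrt 5 * (b + d) * (v - u)) * (real_of_int b)\<^sup>2 +
        (sqrt 5 * b * u) * (real_of_int (b + d))\<^sup>2"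
      by (simp add: power2_eq_square algebra_simps)
    also have "\<dots> \<ge> (real_of_int b)\<^sup>2 + (real_of_int (b + d))\<^sup>2"
      using sq[OF ge(1)] sq[OF ge3] by (intro add_mono)
    finally show False
      using hurwitz_contradiction[OF assms(1) 1] by simp
  next
    case False
    then have ge3: "sqrt 5 * (b + d) * (u - v) \<ge> 1" using ge(3) by simp
    have "d * (u - v) + (b + d) * v = 1"
      using uv by (simp add: algebra_simps)
    then have "sqrt 5 * d * (d + b) = sqrt 5 * d * (b + d) * (d * (u - v) + (b + d) * v)"
      by (simp add: add.commute)
    also have "\<dots> = (sqrt 5 * (b + d) * (u - v)) * (real_of_int d)\<^sup>2 +
        (sqrt 5 * d * v) * (real_of_int (d + b))\<^sup>2"
      by (simp add: power2_eq_square algebra_simps)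
    also have "\<dots> \<ge> (real_of_int d)\<^sup>2 + (real_of_int (d + b))\<^sup>2"
      using sq[OF ge(2)] sq[OF ge3] by (intro add_mono)
    finally show False
      using hurwitz_contradiction[OF assms(2), of b] 1 by (simp add: mult_ac add_ac)
  qed
qed

text \<open>Serves twice: in \<open>hurwitz\<close> an error below \<delta> forces a denominator
  beyond \<open>M\<close>, and in \<open>finite_exponents\<close> it keeps the drift per block away
  from 0.\<close>

lemma irrational_approx_gap:
  fixes x :: real
  assumes "x \<notin> \<rat>"
  shows "\<exists>\<delta>>0. \<forall>q p :: int. 0 < q \<and> q \<le> int M \<longrightarrow> \<bar>of_int q * x - of_int p\<bar> \<ge> \<delta>"
proof (induction M)
  case 0
  show ?case by (auto intro: exI[of _ 1])
next
  case (Suc M)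
  then obtain \<delta> where \<delta>: "\<delta> > 0"
    "\<And>q p :: int. 0 < q \<Longrightarrow> q \<le> int M \<Longrightarrow> \<bar>of_int q * x - of_int p\<bar> \<ge> \<delta>"
    by blast
  define y where "y = of_int (int (Suc M)) * x"
  define \<epsilon> where "\<epsilon> = min (frac y) (1 - frac y)"
  have "y \<noteq> of_int \<lfloor>y\<rfloor>"
    unfolding y_def by (rule irrational_mult_int_ne[OF assms]) simp
  then have "\<epsilon> > 0"
    using frac_lt_1[of y] by (auto simp: \<epsilon>_def frac_def) linarith
  moreover have "\<bar>y - of_int p\<bar> \<ge> \<epsilon>" for p :: int
  proof (cases "p \<le> \<lfloor>y\<rfloor>")
    case True
    then have "real_of_int p \<le> \<lfloor>y\<rfloor>" by simp
    then have "y - p \<ge> frac y" unfolding frac_def by linarith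
    then show ?thesis by (simp add: \<epsilon>_def)
  next
    case False
    then have "real_of_int p \<ge> \<lfloor>y\<rfloor> + 1" by linarith
    then have "p - y \<ge> 1 - frac y" unfolding frac_def by linarith
    then show ?thesis by (simp add: \<epsilon>_def)
  qed
  ultimately have "\<forall>q p :: int. 0 < q \<and> q \<le> int (Suc M) \<longrightarrow>
      \<bar>of_int q * x - of_int p\<bar> \<ge> min \<delta> \<epsilon>"
  proof (intro allI impI)
    fix q p :: int
    assume *: "\<And>p. \<bar>y - of_int p\<bar> \<ge> \<epsilon>" and q: "0 < q \<and> q \<le> int (Suc M)"
    show "\<bar>of_int q * x - of_int p\<bar> \<ge> min \<delta> \<epsilon>"
    proof (cases "q = int (Suc M)")
      case True
      then show ?thesis using *[of p] by (auto simp: y_def)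
    next
      case False
      then show ?thesis using \<delta>(2)[of q p] q by auto
    qed
  qed
  with \<delta>(1) \<open>\<epsilon> > 0\<close> show ?case
    by (intro exI[of _ "min \<delta> \<epsilon>"]) auto
qed

theorem hurwitz:
  fixes x :: real
  assumes "x \<notin> \<rat>"
  shows "\<exists>m>M. \<exists>P::int. sqrt 5 * real m * \<bar>real m * x - of_int P\<bar> < 1"
proof -
  obtain \<delta> where \<delta>: "\<delta> > 0"
    "\<And>q p :: int. 0 < q \<Longrightarrow> q \<le> int M \<Longrightarrow> \<bar>of_int q * x - of_int p\<bar> \<ge> \<delta>"
    using irrational_approx_gap[OF assms, of M] by blast
  obtain s :: nat where s: "real s * \<delta> > M"
    using \<open>\<delta> > 0\<close> ex_less_of_nat_mult by blast
  obtain a b c d :: int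
    where h: "b > 0" "d > 0" "b * c - a * d = 1" "of_int a < of_int b * x"
      "of_int d * x < of_int c" "b + d \<ge> int s + 2"
    using farey_neighbours[OF assms, of s] by blast
  \<comment> \<open>A fraction p/q in [a/b, c/d] satisfies |q x - p| <= q/(b d), since the interval
    has length 1/(b d). For q <= M this is below \<delta>, because b d >= b + d - 1 >= s.\<close>
  have inside: "m > M"
    if "int m = q" "q > 0" "a * q \<le> p * b" "p * d \<le> c * q" for m and q p :: int
  proof (rule ccontr)
    assume "\<not> m > M"
    then have "q \<le> int M" using that by simp
    with \<delta>(2) that(2) have *: "\<bar>of_int q * x - of_int p\<bar> \<ge> \<delta>" by simp
    have "real_of_int b * (of_int q * x - of_int p) \<le> of_int q * (of_int b * x - of_int a)"
      using of_int_le_iff[where 'a = real, THEN iffD2, OF that(3)] by (simp add: algebra_simps)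
    from mult_left_mono[OF this, of "of_int d"] h(2)
    have 1: "real_of_int b * d * (of_int q * x - of_int p) \<le> of_int q * (d * (b * x - a))"
      by (simp add: mult_ac)
    have "real_of_int d * (of_int p - of_int q * x) \<le> of_int q * (of_int c - of_int d * x)"
      using of_int_le_iff[where 'a = real, THEN iffD2, OF that(4)] by (simp add: algebra_simps)
    from mult_left_mono[OF this, of "of_int b"] h(1)
    have 2: "real_of_int b * d * (of_int p - of_int q * x) \<le> of_int q * (b * (c - d * x))"
      by (simp add: mult_ac)
    have "real_of_int (b * c - a * d) = 1" using h(3) by simp
    then have uv: "d * (b * x - a) + b * (c - d * x) = 1"
      by (simp add: algebra_simps)
    have "d * (b * x - a) \<ge> 0" "b * (c - d * x) \<ge> 0"
      using h by auto
    with uv have "d * (b * x - a) \<le> 1" "b * (c - d * x) \<le> 1" by auto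
    then have "real_of_int q * (d * (b * x - a)) \<le> q" "real_of_int q * (b * (c - d * x)) \<le> q"
      using that(2) by auto
    with 1 2 have "real_of_int b * d * (of_int q * x - of_int p) \<le> q"
      "real_of_int b * d * (of_int p - of_int q * x) \<le> q"
      by linarith+
    then have "real_of_int b * d * \<bar>of_int q * x - of_int p\<bar> \<le> q"
      by (cases "of_int q * x - of_int p \<ge> 0") auto
    also have "\<dots> \<le> M" using \<open>q \<le> int M\<close> by linarith
    also have "\<dots> < real s * \<delta>" by fact
    also have "\<dots> \<le> real_of_int (b * d) * \<delta>"
    proof -
      have "0 \<le> (b - 1) * (d - 1)" using h by (intro mult_nonneg_nonneg) auto
      then have "int s \<le> b * d" using h(6) by (simp add: algebra_simps)
      then have "real s \<le> real_of_int (b * d)" by linarith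
      then show ?thesis using \<delta>(1) by (intro mult_right_mono) auto
    qed
    also have "\<dots> \<le> real_of_int b * d * \<bar>of_int q * x - of_int p\<bar>"
      using * h(1,2) by simp
    finally show False by simp
  qed
  have fin: ?thesis
    if "q > 0" "a * q \<le> p * b" "p * d \<le> c * q" "sqrt 5 * q * \<bar>q * x - p\<bar> < 1" for q p :: int
  proof (intro exI conjI)
    show "nat q > M" using inside[of "nat q" q p] that by simp
    show "sqrt 5 * real (nat q) * \<bar>real (nat q) * x - of_int p\<bar> < 1" using that by simp
  qed
  from h(3) have ad: "a * d \<le> c * b" by (simp add: mult.commute)
  from hurwitz_farey[OF h(1-5)] show ?thesis
  proof (elim disjE)
    assume "sqrt 5 * b * \<bar>b * x - a\<bar> < 1"
    then show ?thesis using h ad by (intro fin[of b a]) auto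
  next
    assume "sqrt 5 * d * \<bar>d * x - c\<bar> < 1"
    then show ?thesis using h ad by (intro fin[of d c]) auto
  next
    assume "sqrt 5 * (b + d) * \<bar>(b + d) * x - (a + c)\<bar> < 1"
    then show ?thesis using h ad by (intro fin[of "b + d" "a + c"]) (auto simp: algebra_simps)
  qed
qed

subsection \<open>Occurrences and \<open>k\<close>-abelian powers\<close>

lemma num_occurrences_factor:
  "num_occurrences z (map w [s..<s + m]) =
     card {i. i + length z \<le> m \<and> (\<forall>r<length z. w (s + i + r) = z ! r)}"
proof -
  have "take (length z) (drop i (map w [s..<s + m])) = z \<longleftrightarrow> (\<forall>r<length z. w (s + i + r) = z ! r)"
    if "i + length z \<le> m" for i
    using that by (auto simp: list_eq_iff_nth_eq add_ac)
  then show ?thesis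
    unfolding num_occurrences_def by (intro arg_cong[of _ _ card]) auto
qed

section \<open>Occurrence counts determine the ends of a word\<close>

text \<open>Every occurrence of \<open>z\<close> is followed by a letter, except one that ends
  \<open>u\<close>. The indicator of that exception is how counts reveal a suffix.\<close>

lemma num_occurrences_snoc:
  assumes "finite A" "set u \<subseteq> A" "length z \<le> length u"
  shows "num_occurrences z u =
     (\<Sum>a\<in>A. num_occurrences (z @ [a]) u) + of_bool (drop (length u - length z) u = z)"
proof -
  let ?n = "length z"
  define X where "X a = {i. i + length (z @ [a]) \<le> length u \<and> take (length (z @ [a])) (drop i u) = z @ [a]}" for a
  define Y where "Y = {i. i = length u - ?n \<and> drop (length u - ?n) u = z}"
  have fin: "finite (X a)" for a
    by (rule finite_subset[of _ "{..length u}"]) (auto simp: X_def)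
  have X: "X a = {i. i + ?n < length u \<and> take ?n (drop i u) = z \<and> u ! (i + ?n) = a}" for a
    by (auto simp: X_def take_Suc_conv_app_nth)
  have eq: "{i. i + ?n \<le> length u \<and> take ?n (drop i u) = z} = (\<Union>a\<in>A. X a) \<union> Y"
  proof (intro set_eqI iffI)
    fix i
    assume "i \<in> {i. i + ?n \<le> length u \<and> take ?n (drop i u) = z}"
    then have i: "i + ?n \<le> length u" "take ?n (drop i u) = z" by auto
    show "i \<in> (\<Union>a\<in>A. X a) \<union> Y"
    proof (cases "i + ?n < length u")
      case True
      then have "u ! (i + ?n) \<in> A" using assms(2) by auto
      then show ?thesis using i True by (auto simp: X)
    next
      case False
      then have "i = length u - ?n" "take ?n (drop i u) = drop i u" using i(1) by auto
      then show ?thesis using i by (auto simp: Y_def)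
    qed
  next
    fix i
    assume "i \<in> (\<Union>a\<in>A. X a) \<union> Y"
    then show "i \<in> {i. i + ?n \<le> length u \<and> take ?n (drop i u) = z}"
      using assms(3) by (auto simp: X Y_def)
  qed
  have disj: "(\<Union>a\<in>A. X a) \<inter> Y = {}"
    by (auto simp: X Y_def)
  have "num_occurrences z u = card (\<Union>a\<in>A. X a) + card Y"
    unfolding num_occurrences_def eq
    by (intro card_Un_disjoint disj) (auto simp: assms(1) fin Y_def)
  also have "card (\<Union>a\<in>A. X a) = (\<Sum>a\<in>A. card (X a))"
    using assms(1) fin by (intro card_UN_disjoint) (simp_all, auto simp: X)
  also have "card Y = of_bool (drop (length u - ?n) u = z)"
    by (auto simp: Y_def)
  finally show ?thesis
    by (simp add: X_def num_occurrences_def)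
qed

text \<open>Mirror image: only an occurrence at position 0 has no preceding letter. An occurrence of
  \<open>a # z\<close> at i is one of \<open>z\<close> at i + 1, hence the image under
  \<open>Suc\<close>.\<close>

lemma num_occurrences_Cons:
  assumes "finite A" "set u \<subseteq> A" "length z \<le> length u"
  shows "num_occurrences z u =
     (\<Sum>a\<in>A. num_occurrences (a # z) u) + of_bool (take (length z) u = z)"
proof -
  let ?n = "length z"
  define X where "X a = {i. i + length (a # z) \<le> length u \<and> take (length (a # z)) (drop i u) = a # z}" for a
  define Y where "Y = {i::nat. i = 0 \<and> take ?n u = z}"
  have fin: "finite (X a)" for a
    by (rule finite_subset[of _ "{..length u}"]) (auto simp: X_def)
  have X: "X a = {i. Suc i + ?n \<le> length u \<and> take ?n (drop (Suc i) u) = z \<and> u ! i = a}" for a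
    by (auto simp: X_def Cons_nth_drop_Suc[symmetric])
  have eq: "{i. i + ?n \<le> length u \<and> take ?n (drop i u) = z} = Suc ` (\<Union>a\<in>A. X a) \<union> Y"
  proof (intro set_eqI iffI)
    fix i
    assume i: "i \<in> {i. i + ?n \<le> length u \<and> take ?n (drop i u) = z}"
    show "i \<in> Suc ` (\<Union>a\<in>A. X a) \<union> Y"
    proof (cases i)
      case 0
      then show ?thesis using i by (auto simp: Y_def)
    next
      case (Suc j)
      then have "u ! j \<in> A" using i assms(2) by auto
      then have "j \<in> (\<Union>a\<in>A. X a)" using i Suc by (auto simp: X)
      then show ?thesis using Suc by blast
    qed
  next
    fix i
    assume "i \<in> Suc ` (\<Union>a\<in>A. X a) \<union> Y"
    then show "i \<in> {i. i + ?n \<le> length u \<and> take ?n (drop i u) = z}"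
      using assms(3) by (auto simp: X Y_def)
  qed
  have "num_occurrences z u = card (Suc ` (\<Union>a\<in>A. X a)) + card Y"
    unfolding num_occurrences_def eq
    by (intro card_Un_disjoint) (auto simp: assms(1) fin Y_def)
  also have "card (Suc ` (\<Union>a\<in>A. X a)) = card (\<Union>a\<in>A. X a)"
    by (simp add: card_image)
  also have "\<dots> = (\<Sum>a\<in>A. card (X a))"
    using assms(1) fin by (intro card_UN_disjoint) (simp_all, auto simp: X)
  also have "card Y = of_bool (take ?n u = z)"
    by (auto simp: Y_def)
  finally show ?thesis
    by (simp add: X_def num_occurrences_def)
qed

text \<open>For \<open>z\<close> of length k - 1 both \<open>z\<close> and its one-letter extensions
  are short enough for their counts to agree, so the indicators in
  \<open>num_occurrences_snoc\<close> agree too; for the suffix \<open>z\<close> of \<open>u\<close>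
  this indicator is 1.\<close>

lemma k_abelian_equiv_suffix:
  assumes "k_abelian_equiv k u v" "length u = length v" "1 < k" "k - 1 \<le> length u"
  shows "drop (length u - (k - 1)) u = drop (length u - (k - 1)) v"
proof -
  define z where "z = drop (length u - (k - 1)) u"
  have z: "length z = k - 1" using assms(4) by (simp add: z_def)
  let ?A = "set u \<union> set v"
  have eq: "num_occurrences y u = num_occurrences y v" if "y \<noteq> []" "length y \<le> k" for y
    using assms(1) that by (auto simp: k_abelian_equiv_def)
  have "num_occurrences z u = num_occurrences z v"
    using z assms(3) by (intro eq) auto
  moreover have "(\<Sum>a\<in>?A. num_occurrences (z @ [a]) u) = (\<Sum>a\<in>?A. num_occurrences (z @ [a]) v)"
    using z assms(3) by (intro sum.cong refl eq) auto
  ultimately have "(of_bool (drop (length u - length z) u = z) :: nat) =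
      of_bool (drop (length v - length z) v = z)"
    using num_occurrences_snoc[of ?A u z] num_occurrences_snoc[of ?A v z] z assms(2,4) by simp
  then have "drop (length u - length z) u = z \<longleftrightarrow> drop (length v - length z) v = z" unfolding of_bool_eq_iff .
  then show ?thesis
    using z assms(2) by (simp add: z_def)
qed

lemma k_abelian_equiv_prefix:
  assumes "k_abelian_equiv k u v" "length u = length v" "1 < k" "k - 1 \<le> length u"
  shows "take (k - 1) u = take (k - 1) v"
proof -
  define z where "z = take (k - 1) u"
  have z: "length z = k - 1" using assms(4) by (simp add: z_def)
  let ?A = "set u \<union> set v"
  have eq: "num_occurrences y u = num_occurrences y v" if "y \<noteq> []" "length y \<le> k" for y
    using assms(1) that by (auto simp: k_abelian_equiv_def)
  have "num_occurrences z u = num_occurrences z v"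
    using z assms(3) by (intro eq) auto
  moreover have "(\<Sum>a\<in>?A. num_occurrences (a # z) u) = (\<Sum>a\<in>?A. num_occurrences (a # z) v)"
    using z assms(3) by (intro sum.cong refl eq) auto
  ultimately have "(of_bool (take (length z) u = z) :: nat) = of_bool (take (length z) v = z)"
    using num_occurrences_Cons[of ?A u z] num_occurrences_Cons[of ?A v z] z assms(2,4) by simp
  then have "take (length z) u = z \<longleftrightarrow> take (length z) v = z" unfolding of_bool_eq_iff .
  then show ?thesis
    using z assms(2) by (simp add: z_def)
qed

section \<open>Powers as consecutive windows of the infinite word\<close>

lemma concat_eq_factor_nth:
  assumes "map w [s..<s + length (concat us)] = concat us" "\<forall>u\<in>set us. length u = m" "i < length us"
  shows "us ! i = map w [s + i * m..<s + i * m + m]"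
  using assms
proof (induction us arbitrary: s i)
  case Nil
  then show ?case by simp
next
  case (Cons u us)
  have len: "length u = m" using Cons.prems(2) by simp
  have "map w [s..<s + m] @ map w [s + m..<s + m + length (concat us)] = u @ concat us"
    using Cons.prems(1) len upt_add_eq_append[of s "s + m" "length (concat us)"]
    by (simp add: add.assoc)
  then have "map w [s..<s + m] = u" "map w [s + m..<s + m + length (concat us)] = concat us"
    using len by (auto simp: append_eq_append_conv)
  then show ?case
    using Cons.IH[of "s + m" "i - 1"] Cons.prems(2,3) by (cases i) (auto simp: add_ac)
qed

lemma concat_factors:
  "concat (map (\<lambda>i. map w [s + i * m..<s + i * m + m]) [0..<n]) = map w [s..<s + n * m]"
proof (induction n)
  case (Suc n)
  have "[s..<s + Suc n * m] = [s..<s + n * m] @ [s + n * m..<s + n * m + m]"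
    using upt_add_eq_append[of s "s + n * m" m] by (simp add: add_ac)
  with Suc show ?case by simp
qed simp

lemma k_abelian_power_occurs_iff:
  "(\<exists>p. k_abelian_power k m n p \<and> occurs_in p w) \<longleftrightarrow>
     (\<exists>s. \<forall>i<n. \<forall>j<n. k_abelian_equiv k (map w [s + i * m..<s + i * m + m])
                                       (map w [s + j * m..<s + j * m + m]))"
proof
  assume "\<exists>p. k_abelian_power k m n p \<and> occurs_in p w"
  then obtain us s where us: "length us = n" "\<forall>u\<in>set us. length u = m"
    "\<forall>u\<in>set us. \<forall>v\<in>set us. k_abelian_equiv k u v"
    and s: "map w [s..<s + length (concat us)] = concat us"
    unfolding k_abelian_power_def occurs_in_def by blast
  have "k_abelian_equiv k (map w [s + i * m..<s + i * m + m]) (map w [s + j * m..<s + j * m + m])"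
    if "i < n" "j < n" for i j
    using concat_eq_factor_nth[OF s us(2), of i] concat_eq_factor_nth[OF s us(2), of j] us(1,3) that
    by (metis nth_mem)
  then show "\<exists>s. \<forall>i<n. \<forall>j<n. k_abelian_equiv k (map w [s + i * m..<s + i * m + m])
                                       (map w [s + j * m..<s + j * m + m])"
    by blast
next
  assume "\<exists>s. \<forall>i<n. \<forall>j<n. k_abelian_equiv k (map w [s + i * m..<s + i * m + m])
                                       (map w [s + j * m..<s + j * m + m])"
  then obtain s where s: "\<forall>i<n. \<forall>j<n. k_abelian_equiv k (map w [s + i * m..<s + i * m + m])
                                       (map w [s + j * m..<s + j * m + m])" ..
  let ?us = "map (\<lambda>i. map w [s + i * m..<s + i * m + m]) [0..<n]"
  have "k_abelian_power k m n (concat ?us)"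
    unfolding k_abelian_power_def using s by (intro exI[of _ ?us]) auto
  moreover have "occurs_in (concat ?us) w"
    unfolding occurs_in_def concat_factors by (intro exI[of _ s]) simp
  ultimately show "\<exists>p. k_abelian_power k m n p \<and> occurs_in p w" by blast
qed

subsection \<open>Sturmian words as codings of a rotation\<close>

lemma frac_add_mult_frac: "frac (x + real n * frac \<alpha>) = frac (x + real n * \<alpha>)"
proof -
  have "x + real n * \<alpha> = x + real n * frac \<alpha> + of_int (int n * \<lfloor>\<alpha>\<rfloor>)"
    by (simp add: frac_def algebra_simps)
  then show ?thesis by (simp only: frac_add_of_int_right)
qed

lemma frac_one_minus:
  assumes "\<alpha> \<notin> \<rat>"
  shows "frac (1 - \<alpha>) = 1 - frac \<alpha>"
proof -
  have "\<alpha> \<notin> \<int>" using assms Ints_subset_Rats by blast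
  moreover have "frac (1 - \<alpha>) = frac (- \<alpha> + of_int 1)" by simp
  ultimately show ?thesis by (simp only: frac_add_of_int_right frac_neg if_False)
qed

text \<open>The letter tells whether the step by \<open>frac \<alpha>\<close> reaches the next
  integer. As increments of \<open>floor\<close>, letters telescope when summed over a
  block.\<close>

lemma sturmian_lower_floor:
  assumes "\<alpha> \<notin> \<rat>"
  shows "int (sturmian_lower \<alpha> x n) = \<lfloor>x + real (Suc n) * frac \<alpha>\<rfloor> - \<lfloor>x + real n * frac \<alpha>\<rfloor>"
proof -
  define y where "y = x + real n * frac \<alpha>"
  have "frac (x + real n * \<alpha>) = frac y"
    unfolding y_def frac_add_mult_frac ..
  then have "int (sturmian_lower \<alpha> x n) = (if frac y + frac \<alpha> < 1 then 0 else 1)"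
    unfolding sturmian_lower_def frac_one_minus[OF assms] by auto
  also have "\<dots> = \<lfloor>y + frac \<alpha>\<rfloor> - \<lfloor>y\<rfloor>"
    unfolding floor_add by (simp add: frac_lt_1)
  also have "y + frac \<alpha> = x + real (Suc n) * frac \<alpha>"
    by (simp add: y_def algebra_simps)
  finally show ?thesis by (simp only: y_def)
qed

lemma sturmian_upper_ceiling:
  assumes "\<alpha> \<notin> \<rat>"
  shows "int (sturmian_upper \<alpha> x n) = \<lceil>x + real (Suc n) * frac \<alpha>\<rceil> - \<lceil>x + real n * frac \<alpha>\<rceil>"
proof -
  define y where "y = x + real n * frac \<alpha>"
  have \<alpha>: "0 < frac \<alpha>" "frac \<alpha> < 1"
    using assms Ints_subset_Rats by (auto simp: frac_lt_1)
  have y: "y = of_int \<lfloor>y\<rfloor> + frac y" "0 \<le> frac y" "frac y < 1"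
    using frac_lt_1[of y] by (simp_all add: frac_def)
  have "frac (x + real n * \<alpha>) = frac y"
    unfolding y_def frac_add_mult_frac ..
  then have "int (sturmian_upper \<alpha> x n) = (if 0 < frac y \<and> frac y + frac \<alpha> \<le> 1 then 0 else 1)"
    unfolding sturmian_upper_def frac_one_minus[OF assms] by auto
  also have "\<dots> = \<lceil>y + frac \<alpha>\<rceil> - \<lceil>y\<rceil>"
  proof -
    consider "frac y = 0" | "0 < frac y" "frac y + frac \<alpha> \<le> 1" | "0 < frac y" "1 < frac y + frac \<alpha>"
      using y(2) by linarith
    then show ?thesis
    proof cases
      \<comment> \<open>At an integer the ceiling jumps with the very next step, in accordance with
        the letter 1 at fractional part 0.\<close>
      case 1
      then have "\<lceil>y\<rceil> = \<lfloor>y\<rfloor>" "\<lceil>y + frac \<alpha>\<rceil> = \<lfloor>y\<rfloor> + 1"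
        using y \<alpha> by (intro ceiling_unique; linarith)+
      with 1 show ?thesis by simp
    next
      case 2
      then have "\<lceil>y\<rceil> = \<lfloor>y\<rfloor> + 1" "\<lceil>y + frac \<alpha>\<rceil> = \<lfloor>y\<rfloor> + 1"
        using y \<alpha> by (intro ceiling_unique; simp; linarith)+
      with 2 show ?thesis by simp
    next
      case 3
      then have "\<lceil>y\<rceil> = \<lfloor>y\<rfloor> + 1" "\<lceil>y + frac \<alpha>\<rceil> = \<lfloor>y\<rfloor> + 2"
        using y \<alpha> by (intro ceiling_unique; simp; linarith)+
      with 3 show ?thesis by simp
    qed
  qed
  also have "y + frac \<alpha> = x + real (Suc n) * frac \<alpha>"
    by (simp add: y_def algebra_simps)
  finally show ?thesis by (simp only: y_def)
qed

text \<open>Lets the upper bounds on exponents treat both interval conventions at once: besides the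
  increments they use only bounds on the difference between \<open>F z\<close> and z.\<close>

lemma sturmian_word_rounding:
  assumes "\<alpha> \<notin> \<rat>" "sturmian_word \<alpha> w"
  obtains x and F :: "real \<Rightarrow> int" where "F \<in> {floor, ceiling}"
    "\<And>n. int (w n) = F (x + real (Suc n) * frac \<alpha>) - F (x + real n * frac \<alpha>)"
    "\<And>n. w n \<le> 1"
proof -
  from assms(2) obtain x where "w = sturmian_lower \<alpha> x \<or> w = sturmian_upper \<alpha> x"
    unfolding sturmian_word_def by blast
  then show ?thesis
  proof
    assume "w = sturmian_lower \<alpha> x"
    then show ?thesis
      using sturmian_lower_floor[OF assms(1), of x]
      by (intro that[of floor x]) (auto simp: sturmian_lower_def)
  next
    assume "w = sturmian_upper \<alpha> x"
    then show ?thesis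
      using sturmian_upper_ceiling[OF assms(1), of x]
      by (intro that[of ceiling x]) (auto simp: sturmian_upper_def)
  qed
qed

section \<open>Step functions on the circle and counting along an orbit\<close>

text \<open>Induction on the largest breakpoint: once the jump there is subtracted, the function
  depends only on the other breakpoints.\<close>

lemma step_function_expansion:
  fixes g :: "real \<Rightarrow> real"
  assumes "finite E" "E \<subseteq> {0<..<1}"
    and "\<And>y y'. y \<in> {0..<1} \<Longrightarrow> y' \<in> {0..<1} \<Longrightarrow> (\<forall>e\<in>E. e \<le> y \<longleftrightarrow> e \<le> y') \<Longrightarrow> g y = g y'"
  shows "\<exists>C c. \<forall>y\<in>{0..<1}. g y = C + (\<Sum>e\<in>E. c e * of_bool (e \<le> y))"
  using assms
proof (induction E arbitrary: g rule: finite_linorder_max_induct)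
  case empty
  have "g y = g 0" if "y \<in> {0..<1}" for y
    using that by (intro empty(2)) auto
  then show ?case unfolding sum.empty add_0_right by blast
next
  case (insert b E)
  \<comment> \<open>A sample point of the piece just left of \<open>b\<close>; the 0 serves when
    \<open>b\<close> is the only breakpoint.\<close>
  define e' where "e' = Max (insert 0 E)"
  have b: "0 < b" "b < 1" using insert.prems(1) by auto
  have e': "0 \<le> e'" "e' < b" "\<And>e. e \<in> E \<Longrightarrow> e \<le> e'"
    using insert.hyps b by (auto simp: e'_def)
  define d where "d = g b - g e'"
  define h where "h y = g y - d * of_bool (b \<le> y)" for y
  have h_low: "h y = h y'"
    if "y \<in> {0..<1}" "y' \<in> {0..<1}" "\<forall>e\<in>E. e \<le> y \<longleftrightarrow> e \<le> y'" "y < b" "b \<le> y'" for y y'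
  proof -
    have "\<forall>e\<in>insert b E. e \<le> y' \<longleftrightarrow> e \<le> b"
      using that(5) insert.hyps(2) by (auto intro: less_imp_le order.trans)
    then have "g y' = g b"
      using that(2) b by (intro insert.prems(2)) auto
    moreover have "\<forall>e\<in>insert b E. e \<le> y \<longleftrightarrow> e \<le> e'"
      using that(3-5) e' insert.hyps(2) by (auto intro: less_imp_le order.trans)
    then have "g y = g e'"
      using that(1) b e' by (intro insert.prems(2)) auto
    ultimately show ?thesis using that by (simp add: h_def d_def)
  qed
  have "h y = h y'"
    if "y \<in> {0..<1}" "y' \<in> {0..<1}" "\<forall>e\<in>E. e \<le> y \<longleftrightarrow> e \<le> y'" for y y'
  proof -
    consider "b \<le> y \<longleftrightarrow> b \<le> y'" | "y < b" "b \<le> y'" | "y' < b" "b \<le> y" by linarith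
    then show ?thesis
    proof cases
      case 1
      then have "g y = g y'" using that by (intro insert.prems(2)) auto
      with 1 show ?thesis by (simp add: h_def)
    next
      case 2
      then show ?thesis using h_low[of y y'] that by simp
    next
      case 3
      then show ?thesis using h_low[of y' y] that by simp
    qed
  qed
  moreover have "E \<subseteq> {0<..<1}" using insert.prems(1) by simp
  ultimately have "\<exists>C c. \<forall>y\<in>{0..<1}. h y = C + (\<Sum>e\<in>E. c e * of_bool (e \<le> y))"
    by (intro insert.IH) assumption+
  then obtain C c where c: "\<forall>y\<in>{0..<1}. h y = C + (\<Sum>e\<in>E. c e * of_bool (e \<le> y))"
    by blast
  have bE: "b \<notin> E" using insert.hyps by auto
  show ?case
  proof (intro exI ballI)
    fix y :: real
    assume "y \<in> {0..<1}"
    then have "g y = C + (\<Sum>e\<in>E. c e * of_bool (e \<le> y)) + d * of_bool (b \<le> y)"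
      using c by (auto simp: h_def algebra_simps)
    also have "(\<Sum>e\<in>E. c e * of_bool (e \<le> y)) = (\<Sum>e\<in>E. (c(b := d)) e * of_bool (e \<le> y))"
      using bE by (intro sum.cong) auto
    finally show "g y = C + (\<Sum>e\<in>insert b E. (c(b := d)) e * of_bool (e \<le> y))"
      using bE insert.hyps by simp
  qed
qed

text \<open>The jumps of a step function on the circle cancel, so it is a combination of differences
  \<open>\<lfloor>y + j \<beta>\<rfloor> - \<lfloor>y\<rfloor>\<close>. Such differences telescope when summed along an orbit of the rotation.\<close>

lemma periodic_step_function_expansion:
  fixes g :: "real \<Rightarrow> real" and \<beta> :: real
  assumes "\<beta> \<notin> \<rat>"
    and periodic: "\<And>y (n::int). g (y + of_int n) = g y"
    and step: "\<And>y y'. (\<forall>j\<le>l. \<lfloor>y + real j * \<beta>\<rfloor> = \<lfloor>y' + real j * \<beta>\<rfloor>) \<Longrightarrow> g y = g y'"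
  shows "\<exists>C c. \<forall>y. g y = C + (\<Sum>j=1..l. c j * real_of_int (\<lfloor>y + real j * \<beta>\<rfloor> - \<lfloor>y\<rfloor>))"
proof -
  \<comment> \<open>For j >= 1 this is the representative of - j \<beta> in (0, 1), the one place in
    that interval where the floor of y + j \<beta> jumps. Irrationality makes these places distinct,
    so sums over breakpoints are sums over j.\<close>
  define e where "e j = 1 - frac (real j * \<beta>)" for j :: nat
  have irr: "of_int j * \<beta> \<noteq> of_int n" if "j \<noteq> 0" for j n :: int
    using irrational_mult_int_ne[OF assms(1) that] .
  have e_range: "e j \<in> {0<..<1}" if "j \<ge> 1" for j
  proof -
    have "real j * \<beta> \<notin> \<int>"
      using irr[of "int j"] that by (auto elim!: Ints_cases)
    then show ?thesis by (simp add: e_def frac_lt_1)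
  qed
  have inj: "inj_on e {1..l}"
  proof (rule inj_onI)
    fix i j
    assume "e i = e j"
    then have "of_int (int i - int j) * \<beta> = of_int (\<lfloor>real i * \<beta>\<rfloor> - \<lfloor>real j * \<beta>\<rfloor>)"
      by (simp add: e_def frac_def algebra_simps)
    then show "i = j" using irr[of "int i - int j"] by fastforce
  qed
  have floor_zero: "\<lfloor>y\<rfloor> = 0" if "y \<in> {0..<1}" for y :: real
    using that by (auto simp: floor_eq_iff)
  have floor_e: "\<lfloor>y + real j * \<beta>\<rfloor> = \<lfloor>real j * \<beta>\<rfloor> + of_bool (e j \<le> y)"
    if "y \<in> {0..<1}" for y j
  proof -
    have "\<lfloor>y\<rfloor> = 0" "frac y = y" using that floor_zero[OF that] by (auto simp: frac_eq)
    then show ?thesis using floor_add[of y "real j * \<beta>"] by (auto simp: e_def)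
  qed
  have "\<exists>C c. \<forall>y\<in>{0..<1}. g y = C + (\<Sum>x\<in>e ` {1..l}. c x * of_bool (x \<le> y))"
  proof (rule step_function_expansion)
    show "e ` {1..l} \<subseteq> {0<..<1}" using e_range by auto
  next
    fix y y' :: real
    assume y: "y \<in> {0..<1}" "y' \<in> {0..<1}" and eq: "\<forall>x\<in>e ` {1..l}. x \<le> y \<longleftrightarrow> x \<le> y'"
    show "g y = g y'"
    proof (intro step allI impI)
      fix j
      assume "j \<le> l"
      then show "\<lfloor>y + real j * \<beta>\<rfloor> = \<lfloor>y' + real j * \<beta>\<rfloor>"
        using eq y floor_zero[of y] floor_zero[of y'] by (cases "j = 0") (auto simp: floor_e)
    qed
  qed auto
  then obtain C c where c: "\<And>y. y \<in> {0..<1} \<Longrightarrow> g y = C + (\<Sum>x\<in>e ` {1..l}. c x * of_bool (x \<le> y))"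
    by blast
  show ?thesis
  proof (intro exI allI)
    fix y :: real
    have fr: "frac y \<in> {0..<1}" by (simp add: frac_lt_1)
    have *: "real_of_int (\<lfloor>y + real j * \<beta>\<rfloor> - \<lfloor>y\<rfloor>) = of_int \<lfloor>real j * \<beta>\<rfloor> + of_bool (e j \<le> frac y)" for j
    proof -
      have "y + real j * \<beta> = frac y + real j * \<beta> + of_int \<lfloor>y\<rfloor>" by (simp add: frac_def)
      then have "\<lfloor>y + real j * \<beta>\<rfloor> = \<lfloor>frac y + real j * \<beta>\<rfloor> + \<lfloor>y\<rfloor>" by (simp only: floor_add_int)
      then show ?thesis by (simp add: floor_e[OF fr])
    qed
    have "g y = g (frac y)"
      using periodic[of "frac y" "\<lfloor>y\<rfloor>"] by (simp add: frac_def)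
    also have "\<dots> = C + (\<Sum>j=1..l. c (e j) * of_bool (e j \<le> frac y))"
      unfolding c[OF fr] sum.reindex[OF inj] by simp
    also have "\<dots> = C - (\<Sum>j=1..l. c (e j) * of_int \<lfloor>real j * \<beta>\<rfloor>) +
        (\<Sum>j=1..l. c (e j) * real_of_int (\<lfloor>y + real j * \<beta>\<rfloor> - \<lfloor>y\<rfloor>))"
      unfolding * by (simp add: distrib_left sum.distrib)
    finally show "g y = C - (\<Sum>j=1..l. c (e j) * of_int \<lfloor>real j * \<beta>\<rfloor>) +
        (\<Sum>j=1..l. c (e j) * real_of_int (\<lfloor>y + real j * \<beta>\<rfloor> - \<lfloor>y\<rfloor>))" .
  qed
qed

text \<open>With S the partial sums of \<open>f\<close>, both sides are S(n + j) - S(n) - S(j). This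
  trades a sum over a whole block for j terms at either end.\<close>

lemma sum_shift_diff:
  fixes f :: "nat \<Rightarrow> 'a :: ab_group_add"
  shows "(\<Sum>i<n. f (i + j) - f i) = (\<Sum>i<j. f (n + i) - f i)"
proof (induction n)
  case (Suc n)
  have "f (n + j) - f n = (\<Sum>i<j. f (Suc n + i) - f (n + i))"
    using sum_lessThan_telescope[of "\<lambda>i. f (n + i)" j] by simp
  with Suc have "(\<Sum>i<Suc n. f (i + j) - f i) =
      (\<Sum>i<j. f (n + i) - f i) + (\<Sum>i<j. f (Suc n + i) - f (n + i))"
    by simp
  also have "\<dots> = (\<Sum>i<j. f (Suc n + i) - f i)"
    unfolding sum.distrib[symmetric] by (intro sum.cong) auto
  finally show ?case .
qed simp

text \<open>The count is the sum of the indicator \<open>g\<close> along the orbit. Expanding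
  \<open>g\<close> into differences of floors, with coefficients independent of the starting point,
  leaves by \<open>sum_shift_diff\<close> only floors near the two ends, and there the two orbits
  agree.\<close>

lemma card_window_eq:
  fixes \<beta> y y' :: real and a :: "nat \<Rightarrow> int"
  assumes "\<beta> \<notin> \<rat>" "1 \<le> l" "l \<le> k" "k \<le> m"
    and start: "\<And>j. j < k \<Longrightarrow> \<lfloor>y + real j * \<beta>\<rfloor> = \<lfloor>y' + real j * \<beta>\<rfloor>"
    and fin: "\<And>j. m - k < j \<Longrightarrow> j \<le> m \<Longrightarrow> \<lfloor>y + real j * \<beta>\<rfloor> = \<lfloor>y' + real j * \<beta>\<rfloor>"
  shows "card {i. i + l \<le> m \<and> (\<forall>r<l. \<lfloor>y + real (i + r + 1) * \<beta>\<rfloor> - \<lfloor>y + real (i + r) * \<beta>\<rfloor> = a r)} =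
    card {i. i + l \<le> m \<and> (\<forall>r<l. \<lfloor>y' + real (i + r + 1) * \<beta>\<rfloor> - \<lfloor>y' + real (i + r) * \<beta>\<rfloor> = a r)}"
proof -
  define g :: "real \<Rightarrow> real"
    where "g y = of_bool (\<forall>r<l. \<lfloor>y + real (Suc r) * \<beta>\<rfloor> - \<lfloor>y + real r * \<beta>\<rfloor> = a r)" for y
  have "\<exists>C c. \<forall>y. g y = C + (\<Sum>j=1..l. c j * real_of_int (\<lfloor>y + real j * \<beta>\<rfloor> - \<lfloor>y\<rfloor>))"
  proof (rule periodic_step_function_expansion[OF assms(1)])
    fix y :: real and n :: int
    have "\<lfloor>y + of_int n + real j * \<beta>\<rfloor> = \<lfloor>y + real j * \<beta>\<rfloor> + n" for j
    proof -
      have "y + of_int n + real j * \<beta> = y + real j * \<beta> + of_int n" by simp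
      then show ?thesis by (simp only: floor_add_int)
    qed
    then show "g (y + of_int n) = g y" unfolding g_def by (simp del: of_nat_Suc)
  next
    fix y y' :: real
    assume "\<forall>j\<le>l. \<lfloor>y + real j * \<beta>\<rfloor> = \<lfloor>y' + real j * \<beta>\<rfloor>"
    then have "\<lfloor>y + real (Suc r) * \<beta>\<rfloor> = \<lfloor>y' + real (Suc r) * \<beta>\<rfloor> \<and>
        \<lfloor>y + real r * \<beta>\<rfloor> = \<lfloor>y' + real r * \<beta>\<rfloor>" if "r < l" for r
      using that by (simp del: of_nat_Suc)
    then show "g y = g y'" unfolding g_def by (simp del: of_nat_Suc)
  qed
  then obtain C c where c:
    "\<And>y. g y = C + (\<Sum>j=1..l. c j * real_of_int (\<lfloor>y + real j * \<beta>\<rfloor> - \<lfloor>y\<rfloor>))"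
    by blast
  \<comment> \<open>The number of positions for a window of length l; the indices n + i with i < l
    are then the last l ones, ending at m.\<close>
  define n where "n = m - l + 1"
  have card: "real (card {i. i + l \<le> m \<and>
        (\<forall>r<l. \<lfloor>y + real (i + r + 1) * \<beta>\<rfloor> - \<lfloor>y + real (i + r) * \<beta>\<rfloor> = a r)}) =
      real n * C + (\<Sum>j=1..l. c j * (\<Sum>i<j. of_int \<lfloor>y + real (n + i) * \<beta>\<rfloor> - of_int \<lfloor>y + real i * \<beta>\<rfloor>))"
    for y :: real
  proof -
    have shift: "y + real i * \<beta> + real j * \<beta> = y + real (i + j) * \<beta>" for i j
      by (simp add: algebra_simps)
    have "{i. i + l \<le> m \<and> (\<forall>r<l. \<lfloor>y + real (i + r + 1) * \<beta>\<rfloor> - \<lfloor>y + real (i + r) * \<beta>\<rfloor> = a r)} =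
        {i \<in> {..<n}. \<forall>r<l. \<lfloor>y + real (i + r + 1) * \<beta>\<rfloor> - \<lfloor>y + real (i + r) * \<beta>\<rfloor> = a r}"
      using assms(3,4) by (auto simp: n_def)
    also have "real (card \<dots>) = (\<Sum>i<n. g (y + real i * \<beta>))"
      unfolding g_def shift by (simp flip: sum.inter_filter add: of_bool_def)
    also have "\<dots> = (\<Sum>i<n. C + (\<Sum>j=1..l. c j * (of_int \<lfloor>y + real (i + j) * \<beta>\<rfloor> - of_int \<lfloor>y + real i * \<beta>\<rfloor>)))"
      unfolding c shift by simp
    also have "\<dots> = real n * C + (\<Sum>j=1..l. c j * (\<Sum>i<n. of_int \<lfloor>y + real (i + j) * \<beta>\<rfloor> - of_int \<lfloor>y + real i * \<beta>\<rfloor>))"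
      unfolding sum.distrib sum_distrib_left by (subst sum.swap) simp
    also have "\<dots> = real n * C + (\<Sum>j=1..l. c j * (\<Sum>i<j. of_int \<lfloor>y + real (n + i) * \<beta>\<rfloor> - of_int \<lfloor>y + real i * \<beta>\<rfloor>))"
      by (subst sum_shift_diff) simp
    finally show ?thesis .
  qed
  have "(\<Sum>i<j. real_of_int \<lfloor>y + real (n + i) * \<beta>\<rfloor> - of_int \<lfloor>y + real i * \<beta>\<rfloor>) =
      (\<Sum>i<j. of_int \<lfloor>y' + real (n + i) * \<beta>\<rfloor> - of_int \<lfloor>y' + real i * \<beta>\<rfloor>)" if "j \<le> l" for j
  proof (intro sum.cong refl)
    fix i
    assume "i \<in> {..<j}"
    with that assms(3,4) have "i < k" "m - k < n + i" "n + i \<le> m"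
      by (auto simp: n_def)
    with start[of i] fin[of "n + i"] show "real_of_int \<lfloor>y + real (n + i) * \<beta>\<rfloor> - of_int \<lfloor>y + real i * \<beta>\<rfloor> =
        of_int \<lfloor>y' + real (n + i) * \<beta>\<rfloor> - of_int \<lfloor>y' + real i * \<beta>\<rfloor>"
      by (simp del: of_nat_add)
  qed
  then have "real (card {i. i + l \<le> m \<and> (\<forall>r<l. \<lfloor>y + real (i + r + 1) * \<beta>\<rfloor> - \<lfloor>y + real (i + r) * \<beta>\<rfloor> = a r)}) =
    real (card {i. i + l \<le> m \<and> (\<forall>r<l. \<lfloor>y' + real (i + r + 1) * \<beta>\<rfloor> - \<lfloor>y' + real (i + r) * \<beta>\<rfloor> = a r)})"
    unfolding card by simp
  then show ?thesis by simp
qed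

subsection \<open>The lower bound\<close>

text \<open>Pigeonhole: at most 2k - 2 points with nonzero j meet N = 2k - 1 half-open cells of
  length 1/N, so some cell is empty. Irrational points avoid its right end as well, so the finitely
  many points leave room to widen it; hence the strict inequality.\<close>

lemma rotation_long_gap:
  fixes \<beta> :: real and k :: nat
  assumes "\<beta> \<notin> \<rat>" "1 < k"
  obtains a b where "0 \<le> a" "b \<le> 1" "b - a > 1 / (2 * real k - 1)"
    "\<And>j :: int. \<bar>j\<bar> < int k \<Longrightarrow> frac (of_int j * \<beta>) \<notin> {a<..<b}"
proof -
  define N where "N = 2 * k - 1"
  have N: "N > 1" "real N = 2 * real k - 1" using assms(2) by (auto simp: N_def)
  define J where "J = {- int k + 1..int k - 1} - {0}"
  define S where "S = (\<lambda>j. frac (of_int j * \<beta>)) ` J"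
  have "card S \<le> card J" unfolding S_def by (intro card_image_le) (simp add: J_def)
  also have "\<dots> < N" using assms(2) by (simp add: J_def N_def card_Diff_singleton)
  finally have cardS: "card S < N" .
  have finS: "finite S" by (simp add: S_def J_def)
  have irr: "s \<notin> \<rat>" if "s \<in> S" for s
  proof
    assume "s \<in> \<rat>"
    obtain j where j: "j \<noteq> 0" "s = frac (of_int j * \<beta>)" using \<open>s \<in> S\<close> by (auto simp: S_def J_def)
    then have "of_int j * \<beta> / of_int j \<in> \<rat>"
      using \<open>s \<in> \<rat>\<close> by (intro Rats_divide) auto
    with j(1) assms(1) show False by simp
  qed
  have "\<exists>i<N. \<forall>s\<in>S. \<lfloor>real N * s\<rfloor> \<noteq> int i"
  proof (rule ccontr)
    assume "\<not> ?thesis"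
    then have "int ` {..<N} \<subseteq> (\<lambda>s. \<lfloor>real N * s\<rfloor>) ` S" by (force simp: image_iff)
    then have "card (int ` {..<N}) \<le> card ((\<lambda>s. \<lfloor>real N * s\<rfloor>) ` S)"
      using finS by (intro card_mono) auto
    also have "\<dots> \<le> card S" by (intro card_image_le finS)
    finally show False using cardS by (simp add: card_image)
  qed
  then obtain i where i: "i < N" "\<And>s. s \<in> S \<Longrightarrow> \<lfloor>real N * s\<rfloor> \<noteq> int i" by blast
  have out: "s < real i / N \<or> (real i + 1) / N < s" if "s \<in> S" for s
  proof -
    have "s \<noteq> (real i + 1) / N" using irr[OF that] by auto
    moreover have "real N * s < i \<or> real i + 1 \<le> real N * s"
      using i(2)[OF that] by (auto simp: floor_eq_iff not_le not_less)
    ultimately show ?thesis using N(1) by (auto simp: field_simps)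
  qed
  note result = that
  have gap: thesis if ab: "0 \<le> a" "b \<le> 1" "b - a > 1 / real N" "S \<inter> {a<..<b} = {}" for a b
  proof (rule result[of a b])
    show "frac (of_int j * \<beta>) \<notin> {a<..<b}" if "\<bar>j\<bar> < int k" for j :: int
    proof (cases "j = 0")
      case True
      then show ?thesis using ab(1) by simp
    next
      case False
      then have "frac (of_int j * \<beta>) \<in> S" unfolding S_def J_def using that by (intro imageI) auto
      then show ?thesis using ab(4) by auto
    qed
  qed (use ab N(2) in auto)
  have len: "(real i + 1) / N - real i / N = 1 / N" by (simp flip: diff_divide_distrib)
  \<comment> \<open>The gap must stay inside [0, 1] and avoid 0, the point of j = 0: the first cell
    can grow only to the right, any other cell grows to the left.\<close>
  show thesis
  proof (cases "i = 0")
    case True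
    obtain d where d: "d > 0" "\<And>s. s \<in> S \<Longrightarrow> s \<noteq> 1 / N \<Longrightarrow> d \<le> dist (1 / N) s"
      using finite_set_avoid[OF finS] by blast
    show thesis
    proof (rule gap)
      show "min 1 (1 / N + d) - 0 > 1 / real N" using d(1) N(1) by simp
      show "S \<inter> {0<..<min 1 (1 / N + d)} = {}"
      proof (intro equals0I)
        fix s assume s: "s \<in> S \<inter> {0<..<min 1 (1 / N + d)}"
        with out[of s] True have "1 / N < s" by auto
        with d(2)[of s] s show False by (auto simp: dist_real_def)
      qed
    qed auto
  next
    case False
    obtain d where d: "d > 0" "\<And>s. s \<in> S \<Longrightarrow> s \<noteq> i / N \<Longrightarrow> d \<le> dist (i / N) s"
      using finite_set_avoid[OF finS] by blast
    have pos: "real i / N > 0" using False N(1) by simp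
    show thesis
    proof (rule gap)
      show "(real i + 1) / N \<le> 1" using i(1) by (simp add: field_simps)
      show "(real i + 1) / N - max 0 (i / N - d) > 1 / real N"
        using d(1) pos len by (simp add: max_def)
      show "S \<inter> {max 0 (i / N - d)<..<(real i + 1) / N} = {}"
      proof (intro equals0I)
        fix s assume s: "s \<in> S \<inter> {max 0 (i / N - d)<..<(real i + 1) / N}"
        with out[of s] have "s < i / N" by auto
        with d(2)[of s] s show False by (auto simp: dist_real_def)
      qed
    qed auto
  qed
qed

text \<open>The blocks start at the points \<open>y i\<close>, which all stay in the gap, so no block boundary
  crosses one of the points \<open>- j \<beta>\<close>.\<close>

lemma k_abelian_power_in_gap:
  fixes \<alpha> a b :: real and P :: int
  assumes "\<alpha> \<notin> \<rat>" "k \<le> m" "0 \<le> a" "b \<le> 1"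
    and gap: "\<And>j :: int. \<bar>j\<bar> < int k \<Longrightarrow> frac (of_int j * frac \<alpha>) \<notin> {a<..<b}"
    and n: "real n * \<bar>real m * frac \<alpha> - of_int P\<bar> < b - a"
  shows "\<exists>w p. sturmian_word \<alpha> w \<and> k_abelian_power k m n p \<and> occurs_in p w"
proof -
  define \<beta> where "\<beta> = frac \<alpha>"
  define \<eta> where "\<eta> = real m * \<beta> - of_int P"
  \<comment> \<open>The n + 1 block boundaries are placed symmetrically about the middle of the gap,
    so a total drift below b - a fits whatever the sign of \<eta>.\<close>
  define y where "y i = (a + b) / 2 + (real i - real n / 2) * \<eta>" for i :: nat
  define w where "w = sturmian_lower \<alpha> (y 0)"
  have \<beta>: "\<beta> \<notin> \<rat>" using assms(1) by (simp add: \<beta>_def)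
  have y_gap: "y i \<in> {a<..<b}" if "i \<le> n" for i
  proof -
    have "\<bar>(real i - real n / 2) * \<eta>\<bar> \<le> real n / 2 * \<bar>\<eta>\<bar>"
      unfolding abs_mult using that by (intro mult_right_mono abs_leI) auto
    also have "\<dots> < (b - a) / 2" using n by (simp add: \<eta>_def \<beta>_def)
    finally have "\<bar>(real i - real n / 2) * \<eta>\<bar> < (b - a) / 2" .
    then show ?thesis unfolding y_def greaterThanLessThan_iff
      by (simp only: abs_less_iff) (simp add: field_simps)
  qed
  \<comment> \<open>If the floor differed at two points of the gap, the jump between them would be a
    point - j \<beta> modulo 1 inside the gap.\<close>
  have floor_mono_gap: "\<lfloor>x' + of_int j * \<beta>\<rfloor> \<le> \<lfloor>x + of_int j * \<beta>\<rfloor>"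
    if "x \<in> {a<..<b}" "x' \<in> {a<..<b}" "\<bar>j\<bar> < int k" for x x' and j :: int
  proof (rule ccontr)
    define q where "q = \<lfloor>x' + of_int j * \<beta>\<rfloor>"
    assume "\<not> ?thesis"
    then have "x + of_int j * \<beta> < of_int q" by (simp add: q_def floor_less_iff not_le)
    moreover have "of_int q \<le> x' + of_int j * \<beta>" by (simp add: q_def)
    ultimately have r: "of_int q - of_int j * \<beta> \<in> {a<..<b}" using that(1,2) by auto
    have "frac (of_int (- j) * \<beta>) = of_int q - of_int j * \<beta>"
      unfolding frac_unique_iff using r assms(3,4) by auto
    with r gap[of "- j"] that(3) show False by (simp add: \<beta>_def)
  qed
  have floor_eq_gap: "\<lfloor>x + of_int j * \<beta>\<rfloor> = \<lfloor>x' + of_int j * \<beta>\<rfloor>"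
    if "x \<in> {a<..<b}" "x' \<in> {a<..<b}" "\<bar>j\<bar> < int k" for x x' and j :: int
    using floor_mono_gap[OF that] floor_mono_gap[OF that(2,1,3)] by simp
  have y_0: "y 0 + real (i * m + r) * \<beta> = y i + real r * \<beta> + of_int (int i * P)" for i r
    by (simp add: y_def \<eta>_def algebra_simps)
  have y_Suc: "y i + real m * \<beta> = y (Suc i) + of_int P" for i
    by (simp add: y_def \<eta>_def algebra_simps)
  have letter: "int (w (i * m + r)) = \<lfloor>y i + real (r + 1) * \<beta>\<rfloor> - \<lfloor>y i + real r * \<beta>\<rfloor>" for i r
    using sturmian_lower_floor[OF assms(1), of "y 0" "i * m + r"] y_0[of i r] y_0[of i "r + 1"]
    unfolding w_def \<beta>_def[symmetric] by (simp del: of_nat_add of_nat_Suc of_nat_mult)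
  have occ: "num_occurrences z (map w [i * m..<i * m + m]) = card {t. t + length z \<le> m \<and>
      (\<forall>r<length z. \<lfloor>y i + real (t + r + 1) * \<beta>\<rfloor> - \<lfloor>y i + real (t + r) * \<beta>\<rfloor> = int (z ! r))}" for z i
    unfolding num_occurrences_factor letter[symmetric] of_nat_eq_iff by (simp add: add.assoc)
  have "k_abelian_equiv k (map w [i * m..<i * m + m]) (map w [i' * m..<i' * m + m])"
    if "i < n" "i' < n" for i i'
    unfolding k_abelian_equiv_def
  proof (intro allI impI)
    fix z :: "nat list"
    assume z: "z \<noteq> [] \<and> length z \<le> k"
    show "num_occurrences z (map w [i * m..<i * m + m]) = num_occurrences z (map w [i' * m..<i' * m + m])"
      unfolding occ
    proof (rule card_window_eq[OF \<beta> _ _ assms(2)])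
      show "1 \<le> length z" "length z \<le> k" using z by (auto simp: Suc_le_eq)
    next
      fix j
      assume "j < k"
      then show "\<lfloor>y i + real j * \<beta>\<rfloor> = \<lfloor>y i' + real j * \<beta>\<rfloor>"
        using floor_eq_gap[of "y i" "y i'" "int j"] y_gap that by simp
    next
      fix j
      assume j: "m - k < j" "j \<le> m"
      \<comment> \<open>The end of a block is seen from the start of the next one, where the index j
        - m lies in (-k, 0] and the gap applies.\<close>
      have *: "\<lfloor>y t + real j * \<beta>\<rfloor> = \<lfloor>y (Suc t) + of_int (int j - int m) * \<beta>\<rfloor> + P" for t
      proof -
        have "y t + real j * \<beta> = y (Suc t) + of_int (int j - int m) * \<beta> + of_int P"
          using y_Suc[of t] by (simp add: algebra_simps)
        then show ?thesis by (simp only: floor_add_int)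
      qed
      have "\<bar>int j - int m\<bar> < int k" using j assms(2) by linarith
      then show "\<lfloor>y i + real j * \<beta>\<rfloor> = \<lfloor>y i' + real j * \<beta>\<rfloor>"
        unfolding * using floor_eq_gap[of "y (Suc i)" "y (Suc i')" "int j - int m"] y_gap that by simp
    qed
  qed
  then have "\<exists>p. k_abelian_power k m n p \<and> occurs_in p w"
    unfolding k_abelian_power_occurs_iff by (intro exI[of _ 0]) simp
  moreover have "y 0 \<in> {0..<1}" using y_gap[of 0] assms(3,4) by auto
  then have "sturmian_word \<alpha> w" unfolding sturmian_word_def w_def by blast
  ultimately show ?thesis by blast
qed

section \<open>Finiteness of the set of exponents\<close>

lemma num_occurrences_one:
  assumes "\<And>n. w n \<le> (1::nat)"
  shows "int (num_occurrences [1] (map w [s..<s + m])) = (\<Sum>i<m. int (w (s + i)))"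
proof -
  have "num_occurrences [1] (map w [s..<s + m]) = card {i \<in> {..<m}. w (s + i) = 1}"
    unfolding num_occurrences_factor by (intro arg_cong[of _ _ card]) auto
  also have "int \<dots> = (\<Sum>i<m. of_bool (w (s + i) = 1))"
    by (simp add: of_bool_def flip: sum.inter_filter)
  also have "\<dots> = (\<Sum>i<m. int (w (s + i)))"
    using assms by (intro sum.cong) (auto simp: le_Suc_eq)
  finally show ?thesis .
qed

lemma finite_exponents:
  assumes "\<alpha> \<notin> \<rat>" "1 \<le> k" "1 \<le> m"
  shows "finite {n. \<exists>w p. sturmian_word \<alpha> w \<and> k_abelian_power k m n p \<and> occurs_in p w}"
proof -
  have \<beta>: "frac \<alpha> \<notin> \<rat>" using assms(1) by simp
  obtain \<delta> where "\<delta> > 0" and *: "\<And>q c :: int. 0 < q \<Longrightarrow> q \<le> int m \<Longrightarrow> \<bar>of_int q * frac \<alpha> - of_int c\<bar> \<ge> \<delta>"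
    using irrational_approx_gap[OF \<beta>, of m] by blast
  then have \<delta>: "\<delta> > 0" "\<And>c :: int. \<bar>real m * frac \<alpha> - of_int c\<bar> \<ge> \<delta>"
    using *[of "int m"] assms(3) by auto
  have "real n \<le> 2 / \<delta>" if "sturmian_word \<alpha> w" "k_abelian_power k m n p" "occurs_in p w" for n w p
  proof (cases "n = 0")
    note sturmian = that
    case False
    obtain x and F :: "real \<Rightarrow> int" where F: "F \<in> {floor, ceiling}"
      "\<And>n. int (w n) = F (x + real (Suc n) * frac \<alpha>) - F (x + real n * frac \<alpha>)" "\<And>n. w n \<le> 1"
      using sturmian_word_rounding[OF assms(1) sturmian(1)] by metis
    obtain s where s: "\<And>i j. i < n \<Longrightarrow> j < n \<Longrightarrow>
      k_abelian_equiv k (map w [s + i * m..<s + i * m + m]) (map w [s + j * m..<s + j * m + m])"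
      using sturmian(2,3) k_abelian_power_occurs_iff[of k m n w] by blast
    define G where "G t = F (x + real t * frac \<alpha>)" for t :: nat
    have occ: "int (num_occurrences [1] (map w [t..<t + m])) = G (t + m) - G t" for t
      unfolding num_occurrences_one[OF F(3)] F(2) G_def[symmetric]
      using sum_lessThan_telescope[of "\<lambda>i. G (t + i)" m] by simp
    \<comment> \<open>The number of letters 1 common to all blocks. Over n blocks the orbit and its
      rounding differ in growth by n(m \<beta> - c), while rounding at the two ends permits at most
      2.\<close>
    define c where "c = G (s + m) - G s"
    have "G (s + i * m + m) - G (s + i * m) = c" if "i < n" for i
    proof -
      have "num_occurrences [1] (map w [s + i * m..<s + i * m + m]) =
          num_occurrences [1] (map w [s + 0 * m..<s + 0 * m + m])"
        using s[of i 0] that False assms(2) unfolding k_abelian_equiv_def by simp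
      then show ?thesis using occ[of "s + i * m"] occ[of "s + 0 * m"] by (simp add: c_def)
    qed
    then have "G (s + i * m) - G s = int i * c" if "i \<le> n" for i
      using that by (induction i) (force simp: algebra_simps)+
    from this[of n] have "G (s + n * m) - G s = int n * c" by simp
    then have "real_of_int (G (s + n * m)) - of_int (G s) = of_int (int n * c)"
      by (simp flip: of_int_diff)
    moreover have "\<bar>real_of_int (G t) - (x + real t * frac \<alpha>)\<bar> \<le> 1" for t
      using F(1) unfolding G_def by (auto intro!: abs_leI) linarith+
    from this[of "s + n * m"] this[of s]
    have "\<bar>real_of_int (G (s + n * m)) - of_int (G s) - real n * (real m * frac \<alpha>)\<bar> \<le> 2"
      by (simp add: algebra_simps)
    ultimately have "\<bar>real n * (real m * frac \<alpha> - of_int c)\<bar> \<le> 2"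
      by (simp add: algebra_simps abs_minus_commute)
    then have "real n * \<delta> \<le> 2"
      using mult_left_mono[OF \<delta>(2)[of c], of "real n"] by (simp add: abs_mult)
    then show ?thesis using \<delta>(1) by (simp add: field_simps)
  qed (use \<delta>(1) in simp)
  then have "{n. \<exists>w p. sturmian_word \<alpha> w \<and> k_abelian_power k m n p \<and> occurs_in p w} \<subseteq> {..nat \<lfloor>2 / \<delta>\<rfloor>}"
    by (auto simp: le_nat_floor)
  then show ?thesis by (rule finite_subset) simp
qed

theorem k_lagrange_constant_greater:
  assumes "\<alpha> \<notin> \<rat>" "1 < k"
  shows "k_lagrange_constant k \<alpha> > ereal (sqrt 5 / (2 * real k - 1))"
proof -
  have \<beta>: "frac \<alpha> \<notin> \<rat>" using assms(1) by simp
  obtain a b where ab: "0 \<le> a" "b \<le> 1" "b - a > 1 / (2 * real k - 1)"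
    "\<And>j :: int. \<bar>j\<bar> < int k \<Longrightarrow> frac (of_int j * frac \<alpha>) \<notin> {a<..<b}"
    using rotation_long_gap[OF \<beta> assms(2)] by metis
  define L where "L = b - a"
  define N where "N = 2 * real k - 1"
  have N: "N > 0" using assms(2) by (simp add: N_def)
  have L: "L > 1 / N" using ab(3) by (simp add: L_def N_def)
  \<comment> \<open>Strictly between 1/N and L: the slack L - M absorbs the rounding in the exponent
    \<open>n\<close> for large m, and M > 1/N keeps the final bound strict.\<close>
  define M where "M = (L + 1 / N) / 2"
  have M: "M < L" "1 / N < M" using L by (auto simp: M_def)
  have large: "\<exists>m\<ge>t. sqrt 5 * M \<le> real (max_exponent k \<alpha> m) / real m" for t
  proof -
    define T where "T = max (max t k) (nat \<lceil>1 / (sqrt 5 * (L - M))\<rceil>)"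
    obtain m P where m: "m > T" "sqrt 5 * real m * \<bar>real m * frac \<alpha> - of_int P\<bar> < 1"
      using hurwitz[OF \<beta>, of T] by blast
    have mpos: "m \<ge> t" "m \<ge> k" "m > 0" using m(1) by (auto simp: T_def)
    have "1 / (sqrt 5 * (L - M)) \<le> m" using m(1) unfolding T_def by linarith
    then have m_large: "1 \<le> sqrt 5 * (L - M) * m" using M(1) by (simp add: field_simps)
    define \<eta> where "\<eta> = \<bar>real m * frac \<alpha> - of_int P\<bar>"
    have \<eta>: "sqrt 5 * real m * \<eta> < 1" "\<eta> \<ge> 0" using m(2) by (auto simp: \<eta>_def)
    \<comment> \<open>As sqrt 5 m \<eta> < 1, this many blocks drift by less than L.\<close>
    define n where "n = nat \<lfloor>sqrt 5 * L * m\<rfloor>"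
    have Lpos: "L > 0" using L N by (smt (verit) divide_pos_pos)
    then have n: "real n \<le> sqrt 5 * L * m" "sqrt 5 * L * m - 1 \<le> real n"
      using real_of_int_floor_add_one_ge[of "sqrt 5 * L * m"] unfolding n_def by auto
    have "real n * \<eta> \<le> L * (sqrt 5 * m * \<eta>)"
      using mult_right_mono[OF n(1) \<eta>(2)] by (simp add: mult_ac)
    also have "\<dots> < L" using \<eta>(1) Lpos by simp
    finally have "real n * \<bar>real m * frac \<alpha> - of_int P\<bar> < b - a" by (simp add: \<eta>_def L_def)
    then have "\<exists>w p. sturmian_word \<alpha> w \<and> k_abelian_power k m n p \<and> occurs_in p w"
      using k_abelian_power_in_gap[OF assms(1) mpos(2) ab(1,2,4)] by blast
    then have "n \<le> max_exponent k \<alpha> m"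
      unfolding max_exponent_def using assms mpos(3) by (intro Max_ge finite_exponents) auto
    moreover have "sqrt 5 * M * m \<le> real n" using n(2) m_large by (simp add: algebra_simps)
    ultimately have "sqrt 5 * M * m \<le> real (max_exponent k \<alpha> m)" by linarith
    then show ?thesis using mpos by (intro exI[of _ m]) (simp add: field_simps)
  qed
  have "ereal (sqrt 5 * M) \<le> k_lagrange_constant k \<alpha>"
    unfolding k_lagrange_constant_def limsup_INF_SUP
  proof (intro INF_greatest)
    fix t :: nat
    obtain m where "m \<ge> t" "sqrt 5 * M \<le> real (max_exponent k \<alpha> m) / real m" using large by blast
    then show "ereal (sqrt 5 * M) \<le> (SUP m\<in>{t..}. ereal (real (max_exponent k \<alpha> m) / real m))"
      by (intro SUP_upper2[of m]) auto
  qed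
  moreover have "ereal (sqrt 5 / (2 * real k - 1)) < ereal (sqrt 5 * M)"
    using mult_strict_left_mono[OF M(2), of "sqrt 5"] by (simp add: N_def)
  ultimately show ?thesis by (rule less_le_trans[rotated])
qed

subsection \<open>Slopes equivalent to the golden ratio\<close>

text \<open>The n - 1 inner boundaries see the same 2k - 2 letters, which confines one orbit point
  per boundary to a common interval of length L modulo 1. These points advance by m \<alpha>, and n
  - 2 advances must fit into that interval.\<close>

lemma exponent_upper_bound:
  fixes \<alpha> :: real
  assumes "\<alpha> \<notin> \<rat>" "1 < k" "k \<le> m" "0 < \<alpha>" "(2 * real k - 1) * \<alpha> \<le> 1"
    and L: "L = 1 - (2 * real k - 2) * \<alpha>" "L < 1 / 2"
    and w: "sturmian_word \<alpha> w" "k_abelian_power k m n p" "occurs_in p w"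
  shows "\<exists>P :: int. (real n - 2) * \<bar>real m * \<alpha> - of_int P\<bar> \<le> L"
proof (cases "n \<ge> 3")
  case False
  have "L \<ge> \<alpha>" using assms(5) L(1) by (simp add: algebra_simps)
  moreover have "(real n - 2) * \<bar>real m * \<alpha> - of_int 0\<bar> \<le> 0"
    using False by (intro mult_nonpos_nonneg) auto
  ultimately show ?thesis using assms(4) by (intro exI[of _ 0]) linarith
next
  case True
  have "3 * \<alpha> \<le> (2 * real k - 1) * \<alpha>" using assms(2,4) by (intro mult_right_mono) auto
  then have "\<alpha> < 1" using assms(4,5) by linarith
  then have frac: "frac \<alpha> = \<alpha>" using assms(4) by (simp add: frac_eq)
  obtain x and F :: "real \<Rightarrow> int" where F: "F \<in> {floor, ceiling}"
    "\<And>n. int (w n) = F (x + real (Suc n) * \<alpha>) - F (x + real n * \<alpha>)" "\<And>n. w n \<le> 1"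
    using sturmian_word_rounding[OF assms(1) w(1), unfolded frac] by metis
  obtain s where s: "\<And>i j. i < n \<Longrightarrow> j < n \<Longrightarrow>
      k_abelian_equiv k (map w [s + i * m..<s + i * m + m]) (map w [s + j * m..<s + j * m + m])"
    using w(2,3) k_abelian_power_occurs_iff[of k m n w] by blast
  \<comment> \<open>The window starts k - 1 letters before boundary i. For i >= 1 it consists of a
    suffix of block i - 1 and a prefix of block i.\<close>
  define v where "v i = s + i * m - (k - 1)" for i
  have prefix: "w (s + i * m + r) = w (s + j * m + r)" if "i < n" "j < n" "r < k - 1" for i j r
  proof -
    have "take (k - 1) (map w [s + i * m..<s + i * m + m]) ! r =
        take (k - 1) (map w [s + j * m..<s + j * m + m]) ! r"
      using k_abelian_equiv_prefix[OF s[OF that(1,2)]] assms(2,3) by simp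
    then show ?thesis using that(3) assms(3) by simp
  qed
  have suffix: "w (s + i * m + (m - (k - 1)) + r) = w (s + j * m + (m - (k - 1)) + r)"
    if "i < n" "j < n" "r < k - 1" for i j r
  proof -
    have "drop (m - (k - 1)) (map w [s + i * m..<s + i * m + m]) ! r =
        drop (m - (k - 1)) (map w [s + j * m..<s + j * m + m]) ! r"
      using k_abelian_equiv_suffix[OF s[OF that(1,2)]] assms(2,3) by simp
    then show ?thesis using that(3) assms(3) by (simp add: add.assoc)
  qed
  have window: "w (v i + r) = w (v j + r)"
    if ij: "1 \<le> i" "i < n" "1 \<le> j" "j < n" and r: "r < 2 * k - 2" for i j r
  proof (cases "r < k - 1")
    case True
    have v: "v i = s + (i - 1) * m + (m - (k - 1))" if "1 \<le> i" for i
      using that assms(3) unfolding v_def by (cases i) auto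
    show ?thesis unfolding v[OF ij(1)] v[OF ij(3)] using ij True by (intro suffix) auto
  next
    case False
    have v: "v i + r = s + i * m + (r - (k - 1))" if "1 \<le> i" for i
      using that assms(3) False unfolding v_def by (cases i) auto
    show ?thesis unfolding v[OF ij(1)] v[OF ij(3)] using ij r False by (intro prefix) auto
  qed
  \<comment> \<open>Common normalisation: z - F z lies in [\<kappa>, \<kappa> + 1] for the floor and
    for the ceiling.\<close>
  define \<kappa> :: real where "\<kappa> = (if F = floor then 0 else -1)"
  have \<kappa>: "of_int (F z) + \<kappa> \<le> z \<and> z \<le> of_int (F z) + \<kappa> + 1" for z
  proof (cases "F = floor")
    case True
    then show ?thesis unfolding \<kappa>_def by simp
  next
    case False
    then have "F = ceiling" using F(1) by simp
    with False show ?thesis unfolding \<kappa>_def by simp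
  qed
  define Z where "Z r i = x + real (v i + r) * \<alpha>" for r i
  have "\<exists>r lo. \<forall>i. 1 \<le> i \<and> i < n \<longrightarrow> lo \<le> Z r i - of_int (F (Z r i)) \<and> Z r i - of_int (F (Z r i)) \<le> lo + L"
  \<comment> \<open>A letter 1 puts its orbit point into the last \<alpha> <= L of the unit
    interval. If all letters are 0, then 2k - 2 steps cross no integer, which leaves length L for
    the starting point.\<close>
  proof (cases "\<exists>r<2 * k - 2. w (v 1 + r) = 1")
    case one: True
    then obtain r where r: "r < 2 * k - 2" "w (v 1 + r) = 1" by blast
    show ?thesis
    proof (intro exI allI impI)
      fix i
      assume i: "1 \<le> i \<and> i < n"
      have "w (v i + r) = 1" using window[of i 1 r] i r True by simp
      then have "F (Z r i + \<alpha>) = F (Z r i) + 1"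
        using F(2)[of "v i + r"] by (simp add: Z_def algebra_simps)
      then have "of_int (F (Z r i)) + 1 + \<kappa> \<le> Z r i + \<alpha>" using \<kappa>[of "Z r i + \<alpha>"] by simp
      moreover have "\<alpha> \<le> L" using assms(5) L(1) by (simp add: algebra_simps)
      ultimately show "\<kappa> + 1 - \<alpha> \<le> Z r i - of_int (F (Z r i)) \<and>
          Z r i - of_int (F (Z r i)) \<le> \<kappa> + 1 - \<alpha> + L"
        using \<kappa>[of "Z r i"] by linarith
    qed
  next
    case zero: False
    show ?thesis
    proof (intro exI allI impI)
      fix i
      assume i: "1 \<le> i \<and> i < n"
      have "F (Z (Suc r) i) = F (Z r i)" if "r < 2 * k - 2" for r
      proof -
        have "w (v i + r) \<noteq> 1" using window[of i 1 r] i that True zero by auto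
        then have "w (v i + r) = 0" using F(3)[of "v i + r"] by simp
        then show ?thesis using F(2)[of "v i + r"] by (simp add: Z_def)
      qed
      then have "F (Z r i) = F (Z 0 i)" if "r \<le> 2 * k - 2" for r
        using that by (induction r) auto
      from this[of "2 * k - 2"] have "F (Z (2 * k - 2) i) = F (Z 0 i)" by (simp only: order_refl)
      moreover have "Z (2 * k - 2) i = Z 0 i + 1 - L"
        using assms(2) L(1) by (simp add: Z_def of_nat_diff algebra_simps)
      ultimately have "Z 0 i + 1 - L \<le> of_int (F (Z 0 i)) + \<kappa> + 1"
        using \<kappa>[of "Z (2 * k - 2) i"] by simp
      then show "\<kappa> \<le> Z 0 i - of_int (F (Z 0 i)) \<and> Z 0 i - of_int (F (Z 0 i)) \<le> \<kappa> + L"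
        using \<kappa>[of "Z 0 i"] by linarith
    qed
  qed
  then obtain r lo where lo: "\<And>i. 1 \<le> i \<Longrightarrow> i < n \<Longrightarrow>
      lo \<le> Z r i - of_int (F (Z r i)) \<and> Z r i - of_int (F (Z r i)) \<le> lo + L"
    by blast
  define e where "e i = F (Z r i)" for i
  define P where "P = e 2 - e 1"
  have Z_Suc: "Z r (Suc i) = Z r i + real m * \<alpha>" if "1 \<le> i" for i
  proof -
    have "v (Suc i) = v i + m" using that assms(3) by (cases i) (auto simp: v_def)
    then show ?thesis by (simp add: Z_def algebra_simps)
  qed
  have near: "\<bar>real m * \<alpha> - of_int (e (Suc i) - e i)\<bar> \<le> L" if "1 \<le> i" "Suc i < n" for i
    using lo[of i] lo[of "Suc i"] Z_Suc[of i] that unfolding e_def by (simp add: abs_le_iff)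
  \<comment> \<open>Two integers within L < 1/2 of m \<alpha> coincide, so every advance has the
    same integer part and the drifts add up.\<close>
  have step: "e (Suc i) - e i = P" if "1 \<le> i" "Suc i < n" for i
  proof -
    have "\<bar>real_of_int (e (Suc i) - e i - P)\<bar> < 1"
      using near[OF that] near[of 1] True L(2) unfolding P_def by (simp add: numeral_2_eq_2)
    then have "\<bar>e (Suc i) - e i - P\<bar> < 1" by linarith
    then show ?thesis by simp
  qed
  have "Suc i < n \<longrightarrow> Z r (Suc i) - of_int (e (Suc i)) = Z r 1 - of_int (e 1) + real i * (real m * \<alpha> - of_int P)" for i
  proof (induction i)
    case (Suc i)
    show ?case
    proof
      assume "Suc (Suc i) < n"
      then show "Z r (Suc (Suc i)) - of_int (e (Suc (Suc i))) =
          Z r 1 - of_int (e 1) + real (Suc i) * (real m * \<alpha> - of_int P)"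
        using Suc Z_Suc[of "Suc i"] step[of "Suc i"] by (simp add: algebra_simps)
    qed
  qed simp
  from this[of "n - 2"] have "(real n - 2) * (real m * \<alpha> - of_int P) =
      (Z r (n - 1) - of_int (e (n - 1))) - (Z r 1 - of_int (e 1))"
    using True by (simp add: of_nat_diff numeral_2_eq_2 Suc_diff_Suc)
  moreover have "1 < n" "1 \<le> n - 1" "n - 1 < n" using True by auto
  note lo[OF order_refl this(1)] lo[OF this(2,3)]
  ultimately have "\<bar>(real n - 2) * (real m * \<alpha> - of_int P)\<bar> \<le> L"
    unfolding e_def by linarith
  then have "(real n - 2) * \<bar>real m * \<alpha> - of_int P\<bar> \<le> L"
    using True by (simp add: abs_mult)
  then show ?thesis ..
qed

text \<open>\<open>4 A (A p\<^sup>2 + B p q + C q\<^sup>2) = (2 A p + B q)\<^sup>2 - 5 q\<^sup>2\<close>, and the form on the left is a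
  non-zero integer.\<close>

lemma discriminant_5_badly_approximable:
  fixes A B C p q :: int
  assumes "A > 0" "B\<^sup>2 - 4 * A * C = 5" "q > 0" and \<alpha>: "\<alpha> = (sqrt 5 - of_int B) / (2 * of_int A)"
  shows "\<bar>of_int q * \<alpha> - of_int p\<bar> * (of_int A + sqrt 5 * of_int q) \<ge> 1"
proof (cases "\<bar>of_int q * \<alpha> - of_int p\<bar> \<ge> 1")
  case True
  have "1 * 1 \<le> \<bar>of_int q * \<alpha> - of_int p\<bar> * (of_int A + sqrt 5 * of_int q)"
    using assms(1,3) True by (intro mult_mono) (auto intro: add_increasing2)
  then show ?thesis by simp
next
  case False
  define \<epsilon> where "\<epsilon> = \<bar>of_int q * \<alpha> - of_int p\<bar>"
  \<comment> \<open>The small factor of the difference of squares. Its conjugate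
    \<open>X + 2 * sqrt 5 * of_int q\<close> exceeds 2 sqrt 5 q by at most 2A when \<epsilon> < 1,
    which gives the constant \<open>A\<close> in the bound.\<close>
  define X where "X = of_int (2 * A * p + B * q) - sqrt 5 * of_int q"
  define f where "f = A * p\<^sup>2 + B * p * q + C * q\<^sup>2"
  have XA: "X = 2 * of_int A * (of_int p - of_int q * \<alpha>)"
    using assms(1) by (simp add: X_def \<alpha> field_simps)
  have absX: "\<bar>X\<bar> = 2 * of_int A * \<epsilon>"
    using assms(1) unfolding XA \<epsilon>_def by (simp add: abs_mult abs_minus_commute)
  have "4 * A * f = (2 * A * p + B * q)\<^sup>2 - (B\<^sup>2 - 4 * A * C) * q\<^sup>2"
    by (simp add: f_def power2_eq_square algebra_simps)
  then have f: "4 * A * f = (2 * A * p + B * q)\<^sup>2 - 5 * q\<^sup>2" by (simp add: assms(2))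
  have "X * (X + 2 * sqrt 5 * of_int q) = (of_int (2 * A * p + B * q))\<^sup>2 - (sqrt 5)\<^sup>2 * (of_int q)\<^sup>2"
    unfolding X_def by (simp add: power2_eq_square algebra_simps)
  also have "\<dots> = of_int (4 * A * f)" unfolding f by simp
  finally have prod: "X * (X + 2 * sqrt 5 * of_int q) = of_int (4 * A * f)" .
  have "f \<noteq> 0"
  proof
    assume "f = 0"
    with prod have "X = 0 \<or> X + 2 * sqrt 5 * of_int q = 0" by simp
    then have "of_int q * sqrt 5 = of_int (2 * A * p + B * q) \<or>
        of_int (- q) * sqrt 5 = of_int (2 * A * p + B * q)"
      by (auto simp: X_def algebra_simps)
    then show False
      using irrational_mult_int_ne[OF sqrt_5_irrational] assms(3)
      by (metis less_irrefl neg_equal_0_iff_equal)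
  qed
  then have "\<bar>f\<bar> \<ge> 1" by simp
  then have "4 * A * 1 \<le> 4 * A * \<bar>f\<bar>" using assms(1) by (intro mult_left_mono) auto
  then have "4 * A \<le> \<bar>4 * A * f\<bar>" using assms(1) by (simp add: abs_mult)
  then have "real_of_int (4 * A) \<le> of_int \<bar>4 * A * f\<bar>" by (simp only: of_int_le_iff)
  also have "\<dots> = \<bar>X\<bar> * \<bar>X + 2 * sqrt 5 * of_int q\<bar>" unfolding of_int_abs abs_mult[of X, symmetric] prod ..
  also have "\<dots> \<le> (2 * of_int A * \<epsilon>) * (2 * of_int A + 2 * sqrt 5 * of_int q)"
  proof -
    have "2 * of_int A * \<epsilon> \<le> 2 * of_int A * 1"
      using False assms(1) by (intro mult_left_mono) (auto simp: \<epsilon>_def)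
    then have "\<bar>X\<bar> \<le> 2 * of_int A" using absX by simp
    moreover have "0 \<le> 2 * sqrt 5 * of_int q" using assms(3) by simp
    ultimately have "\<bar>X + 2 * sqrt 5 * of_int q\<bar> \<le> 2 * of_int A + 2 * sqrt 5 * of_int q" by linarith
    then show ?thesis unfolding absX[symmetric] by (intro mult_left_mono) auto
  qed
  finally have "4 * of_int A * 1 \<le> 4 * of_int A * (\<epsilon> * (of_int A + sqrt 5 * of_int q))"
    by (simp add: algebra_simps)
  then show ?thesis using assms(1) unfolding \<epsilon>_def[symmetric] by simp
qed

lemma discriminant_5_irrational:
  fixes A B C :: int
  assumes "A > 0" "B\<^sup>2 - 4 * A * C = 5" and \<alpha>: "\<alpha> = (sqrt 5 - of_int B) / (2 * of_int A)"
  shows "\<alpha> \<notin> \<rat>"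
proof
  assume "\<alpha> \<in> \<rat>"
  then have "2 * of_int A * \<alpha> + of_int B \<in> \<rat>" by simp
  also have "2 * of_int A * \<alpha> + of_int B = sqrt 5" using assms(1) by (simp add: \<alpha>)
  finally show False using sqrt_5_irrational by simp
qed

text \<open>Combining (n - 2) |m \<alpha> - P| <= L with |m \<alpha> - P| >= 1/(A + sqrt 5 m) gives
  n <= 2 + L (A + sqrt 5 m); after division by m only sqrt 5 L survives.\<close>

lemma k_lagrange_constant_discriminant_5:
  fixes A B C :: int and \<alpha> :: real
  assumes "A > 0" "B\<^sup>2 - 4 * A * C = 5" and \<alpha>: "\<alpha> = (sqrt 5 - of_int B) / (2 * of_int A)"
    and "1 < k" "0 < \<alpha>" "(2 * real k - 1) * \<alpha> \<le> 1"
    and L: "L = 1 - (2 * real k - 2) * \<alpha>" "L < 1 / 2"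
  shows "k_lagrange_constant k \<alpha> \<le> ereal (sqrt 5 * L)"
proof -
  have irr: "\<alpha> \<notin> \<rat>" using discriminant_5_irrational[OF assms(1-3)] .
  have "L \<ge> \<alpha>" using assms(6) L(1) by (simp add: algebra_simps)
  with assms(5) have Lpos: "L > 0" by simp
  have bound: "real (max_exponent k \<alpha> m) \<le> 2 + L * (of_int A + sqrt 5 * real m)" if m: "k \<le> m" for m
  proof -
    let ?S = "{n. \<exists>w p. sturmian_word \<alpha> w \<and> k_abelian_power k m n p \<and> occurs_in p w}"
    \<comment> \<open>Exponent 0 is vacuous, so the set is nonempty and \<open>Max\<close> is
      attained.\<close>
    have "\<exists>p. k_abelian_power k m 0 p \<and> occurs_in p (sturmian_lower \<alpha> 0)"
      unfolding k_abelian_power_occurs_iff by simp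
    moreover have "sturmian_word \<alpha> (sturmian_lower \<alpha> 0)"
      unfolding sturmian_word_def by (intro bexI[of _ 0]) auto
    ultimately have "?S \<noteq> {}" by blast
    moreover have "finite ?S" using irr assms(4) m by (intro finite_exponents) auto
    ultimately have "max_exponent k \<alpha> m \<in> ?S" unfolding max_exponent_def by (rule Max_in[rotated])
    then obtain w p where w: "sturmian_word \<alpha> w" "k_abelian_power k m (max_exponent k \<alpha> m) p" "occurs_in p w"
      by blast
    define n where "n = max_exponent k \<alpha> m"
    obtain P :: int where P: "(real n - 2) * \<bar>real m * \<alpha> - of_int P\<bar> \<le> L"
      using exponent_upper_bound[OF irr assms(4) m assms(5-8) w] unfolding n_def by blast
    define D where "D = of_int A + sqrt 5 * real m"
    have D: "D > 0" using assms(1) by (simp add: D_def add_pos_nonneg)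
    have "\<bar>real m * \<alpha> - of_int P\<bar> * D \<ge> 1"
      using discriminant_5_badly_approximable[OF assms(1,2) _ \<alpha>, of "int m" P] m assms(4) by (simp add: D_def)
    show ?thesis
    proof (cases "n \<ge> 2")
      case True
      have "(real n - 2) * 1 \<le> (real n - 2) * (\<bar>real m * \<alpha> - of_int P\<bar> * D)"
        using True \<open>\<bar>real m * \<alpha> - of_int P\<bar> * D \<ge> 1\<close> by (intro mult_left_mono) auto
      also have "\<dots> \<le> L * D" using mult_right_mono[OF P, of D] D by (simp add: mult.assoc)
      finally show ?thesis by (simp add: n_def D_def)
    next
      case False
      then have "real n \<le> 2" by simp
      moreover have "L * D > 0" using Lpos D by simp
      ultimately show ?thesis by (simp add: n_def D_def)
    qed
  qed
  have growth: "(\<lambda>m. (2 + L * (a + c * real m)) / real m) \<longlonglongrightarrow> c * L" if "c > 0" for a c :: real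
    using Lpos that by real_asymp
  have "k_lagrange_constant k \<alpha> \<le> limsup (\<lambda>m. ereal ((2 + L * (of_int A + sqrt 5 * real m)) / real m))"
    unfolding k_lagrange_constant_def
    by (intro Limsup_mono eventually_sequentiallyI[of k]) (auto intro!: divide_right_mono bound)
  also have "\<dots> = ereal (sqrt 5 * L)"
    using growth[of "sqrt 5" "of_int A"] by (intro lim_imp_Limsup) auto
  finally show ?thesis .
qed

text \<open>The continued fraction \<open>[0; 2k - 1, t + 1, 1, 1, 1, \<dots>]\<close> is a root of a form of
  discriminant 5 and tends to \<open>1 / (2k - 1)\<close>.\<close>

lemma spectrum_close_to_bound:
  assumes "1 < k" "0 < \<epsilon>"
  obtains r where "r \<in> k_lagrange_spectrum k" "sqrt 5 / (2 * real k - 1) < r"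
    "r < sqrt 5 / (2 * real k - 1) + \<epsilon>"
proof -
  define N :: real where "N = 2 * real k - 1"
  have N: "N \<ge> 3" using assms(1) by (simp add: N_def)
  \<comment> \<open>This is 1/(N + 1/(t + phi)) with phi the golden ratio, since 1 + 1/phi = phi.
    The denominator is rationalised: t^2 + t - 1 and 2t + 1 are norm and trace of t + phi.\<close>
  define \<alpha> where "\<alpha> t = (sqrt 5 + (2 * N * (t\<^sup>2 + t - 1) + 2 * t + 1)) /
    (2 * (N\<^sup>2 * (t\<^sup>2 + t - 1) + N * (2 * t + 1) + 1))" for t :: real
  have "(\<lambda>t::nat. (c + (2 * N * ((real t)\<^sup>2 + real t - 1) + 2 * real t + 1)) /
    (2 * (N\<^sup>2 * ((real t)\<^sup>2 + real t - 1) + N * (2 * real t + 1) + 1))) \<longlonglongrightarrow> N * inverse (N\<^sup>2)" for c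
    using N by real_asymp
  from this[of "sqrt 5"] have "(\<lambda>t::nat. \<alpha> t) \<longlonglongrightarrow> N * inverse (N\<^sup>2)" unfolding \<alpha>_def .
  also have "N * inverse (N\<^sup>2) = 1 / N" using N by (simp add: power2_eq_square field_simps)
  finally have "(\<lambda>t::nat. \<alpha> t) \<longlonglongrightarrow> 1 / N" .
  then have "(\<lambda>t::nat. sqrt 5 * (1 - (N - 1) * \<alpha> t)) \<longlonglongrightarrow> sqrt 5 * (1 - (N - 1) * (1 / N))"
    by (intro tendsto_intros)
  also have "sqrt 5 * (1 - (N - 1) * (1 / N)) = sqrt 5 / N" using N by (simp add: field_simps)
  finally have lim: "(\<lambda>t::nat. sqrt 5 * (1 - (N - 1) * \<alpha> t)) \<longlonglongrightarrow> sqrt 5 / N" .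
  \<comment> \<open>The second inequality, valid as N >= 3, yields L < 1/2 for large t.\<close>
  have "sqrt 5 / N < sqrt 5 / N + \<epsilon>" "sqrt 5 / N < sqrt 5 * (1 / 2)"
    using assms(2) N by (auto simp: field_simps)
  from order_tendstoD(2)[OF lim this(1)] order_tendstoD(2)[OF lim this(2)] eventually_ge_at_top[of 1]
  have "\<forall>\<^sub>F t::nat in at_top. sqrt 5 * (1 - (N - 1) * \<alpha> t) < sqrt 5 / N + \<epsilon> \<and>
      sqrt 5 * (1 - (N - 1) * \<alpha> t) < sqrt 5 * (1 / 2) \<and> 1 \<le> t"
    by eventually_elim simp
  then obtain t :: nat where t: "sqrt 5 * (1 - (N - 1) * \<alpha> t) < sqrt 5 / N + \<epsilon>"
    "sqrt 5 * (1 - (N - 1) * \<alpha> t) < sqrt 5 * (1 / 2)" "1 \<le> t"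
    by (auto simp: eventually_at_top_linorder)
  define M :: int where "M = 2 * int k - 1"
  \<comment> \<open>\<open>C\<close> and \<open>A\<close> are the norms of t + phi and N(t + phi) +
    1; t >= 1 makes \<open>C\<close> positive.\<close>
  define C :: int where "C = (int t)\<^sup>2 + int t - 1"
  define B :: int where "B = - (2 * M * C + 2 * int t + 1)"
  define A :: int where "A = M\<^sup>2 * C + M * (2 * int t + 1) + 1"
  have NM: "N = of_int M" by (simp add: N_def M_def)
  have C: "C \<ge> 1" using t(3) one_le_power[of "int t" 2] unfolding C_def by linarith
  have M: "M \<ge> 3" using N NM by linarith
  have A: "A > 0" using C M unfolding A_def by (intro add_nonneg_pos add_nonneg_nonneg mult_nonneg_nonneg) auto
  have "B\<^sup>2 - 4 * A * C = (2 * int t + 1)\<^sup>2 - 4 * C"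
    unfolding A_def B_def by (simp add: power2_eq_square algebra_simps)
  also have "\<dots> = 5" by (simp add: C_def power2_eq_square algebra_simps)
  finally have disc: "B\<^sup>2 - 4 * A * C = 5" .
  have \<alpha>: "\<alpha> t = (sqrt 5 - of_int B) / (2 * of_int A)"
    by (simp add: \<alpha>_def A_def B_def C_def NM)
  have "0 \<le> M * C" using C M by simp
  then have "B < 0" unfolding B_def by linarith
  then have pos: "\<alpha> t > 0" unfolding \<alpha> using A by (intro divide_pos_pos) (auto intro: order.strict_trans[of _ 0])
  have "N * (sqrt 5 - of_int B) \<le> 2 * of_int A"
  proof -
    have "sqrt 5 \<le> 3" by (rule real_le_lsqrt) auto
    then have "N * sqrt 5 \<le> N * (2 * real t + 1)"
      using N t(3) by (intro mult_left_mono) auto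
    then show ?thesis
      by (simp add: A_def B_def NM power2_eq_square algebra_simps)
  qed
  then have le: "(2 * real k - 1) * \<alpha> t \<le> 1"
    unfolding N_def[symmetric] \<alpha> using A by (simp add: field_simps)
  define L where "L = 1 - (2 * real k - 2) * \<alpha> t"
  have LN: "L = 1 - (N - 1) * \<alpha> t" by (simp add: L_def N_def)
  have "L < 1 / 2" using t(2) unfolding LN by simp
  have upper: "k_lagrange_constant k (\<alpha> t) \<le> ereal (sqrt 5 * L)"
    by (rule k_lagrange_constant_discriminant_5[OF A disc \<alpha> assms(1) pos le L_def \<open>L < 1 / 2\<close>])
  have irr: "\<alpha> t \<notin> \<rat>" by (rule discriminant_5_irrational[OF A disc \<alpha>])
  have lower: "ereal (sqrt 5 / (2 * real k - 1)) < k_lagrange_constant k (\<alpha> t)"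
    by (rule k_lagrange_constant_greater[OF irr assms(1)])
  obtain r where r: "k_lagrange_constant k (\<alpha> t) = ereal r"
    using upper lower by (cases "k_lagrange_constant k (\<alpha> t)") auto
  show thesis
  proof (rule that[of r])
    show "r \<in> k_lagrange_spectrum k" unfolding k_lagrange_spectrum_def using irr r by blast
    show "sqrt 5 / (2 * real k - 1) < r" using lower r by simp
    show "r < sqrt 5 / (2 * real k - 1) + \<epsilon>"
      using upper t(1) unfolding r LN[symmetric] N_def[symmetric] by simp
  qed
qed

theorem theorem3p14:
  fixes k :: nat
  assumes "k > 1"
  shows "k_lagrange_spectrum k \<subseteq> {sqrt 5 / (2 * real k - 1)<..}
    \<and> (sqrt 5 / (2 * real k - 1)) islimpt k_lagrange_spectrum k
    \<and> (\<forall>y. y islimpt k_lagrange_spectrum k \<longrightarrow> sqrt 5 / (2 * real k - 1) \<le> y)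
    \<and> \<not> closed (k_lagrange_spectrum k)"
proof -
  let ?c = "sqrt 5 / (2 * real k - 1)"
  have sub: "k_lagrange_spectrum k \<subseteq> {?c<..}"
    using k_lagrange_constant_greater[OF _ assms] by (fastforce simp: k_lagrange_spectrum_def)
  have lim: "?c islimpt k_lagrange_spectrum k"
    unfolding islimpt_approachable
  proof (intro allI impI)
    fix \<epsilon> :: real
    assume "\<epsilon> > 0"
    then obtain r where "r \<in> k_lagrange_spectrum k" "?c < r" "r < ?c + \<epsilon>"
      using spectrum_close_to_bound[OF assms] by metis
    then show "\<exists>r\<in>k_lagrange_spectrum k. r \<noteq> ?c \<and> dist r ?c < \<epsilon>"
      by (intro bexI[of _ r]) (auto simp: dist_real_def)
  qed
  have "?c \<le> y" if "y islimpt k_lagrange_spectrum k" for y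
  proof -
    have "y islimpt {?c..}" by (rule islimpt_subset[OF that]) (use sub in auto)
    then show ?thesis using closed_limpt[of "{?c..}"] by simp
  qed
  moreover have "\<not> closed (k_lagrange_spectrum k)"
    using lim sub unfolding closed_limpt by blast
  ultimately show ?thesis using sub lim by blast
qed

end
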